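(* Let $q$ be an odd prime power and $\Gamma=Sp_4(\mathbb F_q[T])$ (the $4\times4$ matrices $A$ over $\mathbb F_q[T]$ with $A^tJA=J$, $J$ having $J_{14}=J_{23}=1$, $J_{32}=J_{41}=-1$, other entries $0$). There exists a length function $\ell$ on $\Gamma$, bi-Lipschitz equivalent to its word length, such that for every $p\in(4,\infty)$ the constant function $1$ on $\Gamma$ is not the pointwise limit of any family $(f_\alpha)_{\alpha\in I}$ of finitely supported $\ell$-radial functions on $\Gamma$ with $\sup_\alpha\|m_{f_\alpha}\|_{MS^p(\ell^2\Gamma)}<\infty$.
   Context: A length function is $\ell:\Gamma\to\mathbb R_{\ge0}$ with $\ell(\gamma\gamma')\le\ell(\gamma)+\ell(\gamma')$; $f$ is $\ell$-radial if $f(\gamma)=f(\gamma')$ whenever $\ell(\gamma)=\ell(\gamma')$. For $f:\Gamma\to\mathbb C$, $m_f$ is the Schur multiplier $(T_{x,y})_{x,y\in\Gamma}\mapsto(f(x^{-1}y)T_{x,y})$ and $\|m_f\|_{MS^p(\ell^2\Gamma)}$ is its (not necessarily completely bounded) operator norm on the Schatten class $S^p(\ell^2\Gamma)$. *)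

theory Defs
  imports "HOL-Analysis.Analysis" "HOL-Computational_Algebra.Polynomial"
    "Jordan_Normal_Form.Char_Poly"
begin

text \<open>Matrices are JNF matrices with indices 0..3, so J_{14}=J_{23}=1, J_{32}=J_{41}=-1
  become the entries (0,3),(1,2) equal to 1 and (2,1),(3,0) equal to -1.\<close>

definition J_sp :: "'k::comm_ring_1 poly mat" where
  "J_sp = mat 4 4 (\<lambda>(i,j). if (i,j) = (0,3) \<or> (i,j) = (1,2) then 1
                         else if (i,j) = (2,1) \<or> (i,j) = (3,0) then -1 else 0)"

definition Sp4 :: "'k::comm_ring_1 poly mat set" where
  "Sp4 = {A. A \<in> carrier_mat 4 4 \<and> transpose_mat A * J_sp * A = J_sp}"

definition sp_inv :: "'k::comm_ring_1 poly mat \<Rightarrow> 'k poly mat" where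
  "sp_inv A = (THE B. B \<in> carrier_mat 4 4 \<and> A * B = 1\<^sub>m 4 \<and> B * A = 1\<^sub>m 4)"

definition is_length_fun :: "'k::comm_ring_1 poly mat set \<Rightarrow> ('k poly mat \<Rightarrow> real) \<Rightarrow> bool" where
  "is_length_fun G l \<longleftrightarrow> (\<forall>g\<in>G. l g \<ge> 0) \<and> (\<forall>g\<in>G. \<forall>h\<in>G. l (g * h) \<le> l g + l h)"

definition word_prod :: "'k::comm_ring_1 poly mat list \<Rightarrow> 'k poly mat" where
  "word_prod xs = foldr (*) xs (1\<^sub>m 4)"

definition generates :: "'k::comm_ring_1 poly mat set \<Rightarrow> 'k poly mat set \<Rightarrow> bool" where
  "generates S G \<longleftrightarrow> S \<subseteq> G \<and>
     (\<forall>g\<in>G. \<exists>xs. set xs \<subseteq> S \<union> sp_inv ` S \<and> word_prod xs = g)"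

definition word_length :: "'k::comm_ring_1 poly mat set \<Rightarrow> 'k poly mat \<Rightarrow> nat" where
  "word_length S g = (LEAST n. \<exists>xs. length xs = n \<and> set xs \<subseteq> S \<union> sp_inv ` S \<and> word_prod xs = g)"

definition radial_on :: "'a set \<Rightarrow> ('a \<Rightarrow> real) \<Rightarrow> ('a \<Rightarrow> complex) \<Rightarrow> bool" where
  "radial_on G l f \<longleftrightarrow> (\<forall>g\<in>G. \<forall>h\<in>G. l g = l h \<longrightarrow> f g = f h)"

definition fin_supp_on :: "'a set \<Rightarrow> ('a \<Rightarrow> complex) \<Rightarrow> bool" where
  "fin_supp_on G f \<longleftrightarrow> finite {g\<in>G. f g \<noteq> 0}"

definition enum_set :: "'a set \<Rightarrow> 'a list" where
  "enum_set F = (SOME xs. distinct xs \<and> set xs = F)"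

definition idx_mat :: "'a set \<Rightarrow> ('a \<Rightarrow> 'a \<Rightarrow> complex) \<Rightarrow> complex mat" where
  "idx_mat F T = (let xs = enum_set F in
      mat (length xs) (length xs) (\<lambda>(i,j). T (xs ! i) (xs ! j)))"

definition gram_mat :: "complex mat \<Rightarrow> complex mat" where
  "gram_mat M = mat (dim_col M) (dim_col M)
      (\<lambda>(i,j). \<Sum>k<dim_row M. cnj (M $$ (k,i)) * M $$ (k,j))"

text \<open>Schatten p-norm: (sum of singular values to the power p)^(1/p); the singular values
  are the square roots of the eigenvalues (with algebraic multiplicity) of T^* T.\<close>
definition schatten_norm :: "real \<Rightarrow> 'a set \<Rightarrow> ('a \<Rightarrow> 'a \<Rightarrow> complex) \<Rightarrow> real" where
  "schatten_norm p F T = (let P = char_poly (gram_mat (idx_mat F T)) in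
      (\<Sum>x\<in>{x. poly P x = 0}. real (order x P) * (cmod x) powr (p / 2)) powr (1 / p))"

text \<open>m_f has operator norm at most C on S^p(l^2 G), tested on finitely supported
  matrices (compressions to l^2 F, F finite).\<close>
definition schur_bounded :: "real \<Rightarrow> 'k::comm_ring_1 poly mat set \<Rightarrow> ('k poly mat \<Rightarrow> complex) \<Rightarrow> real \<Rightarrow> bool" where
  "schur_bounded p G f C \<longleftrightarrow>
     (\<forall>F T. finite F \<and> F \<subseteq> G \<longrightarrow>
        schatten_norm p F (\<lambda>x y. f (sp_inv x * y) * T x y) \<le> C * schatten_norm p F T)"

end

theory Submission
  imports Defs "Jordan_Normal_Form.Schur_Decomposition"
begin

text \<open>
  The length is \<open>1 + mdeg g\<close>, where \<open>mdeg\<close> is the largest degree of an entry. It is equivalent to the word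
  length because elementary matrices are undistorted: the matrix \<open>A\<close> with rows \<open>(T, 1)\<close> and
  \<open>(-1, 0)\<close> satisfies \<open>A + A\<inverse> = T\<close>, so conjugation by \<open>A\<close> inside a Heisenberg subgroup writes
  \<open>P \<in> F\<^sub>q[T]\<close> with \<open>O(deg P)\<close> letters up to the centre, commutators reach the centre (here 2 must
  be invertible), and the Euclidean algorithm in three copies of \<open>SL\<^sub>2\<close> reduces any matrix to the
  Heisenberg subgroup.

  For the multipliers, index rows and columns by \<open>(a, b)\<close> and \<open>(c, d)\<close> with \<open>a, c\<close> of degree less than
  \<open>n\<close> and \<open>b, d\<close> of degree less than \<open>2n\<close>, embedded in the Heisenberg group so that \<open>x\<inverse> y\<close> has central
  coordinate \<open>u = b + d + a c\<close>. Let \<open>M\<close> have entries \<open>t(u)\<close>, where \<open>t\<close> is the difference of the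
  uniform measures on polynomials of degree \<open>n\<close> and \<open>n + 1\<close>. The entries of \<open>M\<^sup>* M\<close> vanish unless
  \<open>c - c'\<close> has degree at most 1, so its norm is \<open>O(q\<^sup>n)\<close>, while the multiplier turns \<open>M\<close> into a
  matrix with singular value \<open>q\<^sup>n |\<phi>(n) - \<phi>(n + 1)|\<close>, \<open>\<phi>\<close> being the radial profile. Comparing
  Schatten norms bounds \<open>|\<phi>(n) - \<phi>(n + 1)|\<close> by a constant times \<open>q\<close> to the power \<open>-n (1/2 - 2/p)\<close>, which
  is summable for \<open>p > 4\<close>; finite support then makes \<open>\<phi>(n)\<close> uniformly small for large \<open>n\<close>.
\<close>

section \<open>Schatten norms of finite matrices\<close>

text \<open>Turns the sum over roots with multiplicity in \<open>schatten_norm\<close> into a sum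
  over a list of eigenvalues. By induction: a new linear factor raises the multiplicity by one, and
  at a single point.\<close>

lemma sum_roots_prod_list_linear:
  fixes h :: "complex \<Rightarrow> real"
  shows "(\<Sum>x\<in>{x. poly (\<Prod>a\<leftarrow>es. [:- a, 1:]) x = 0}. real (Polynomial.order x (\<Prod>a\<leftarrow>es. [:- a, 1:])) * h x)
    = sum_list (map h es)"
proof (induction es)
  case Nil
  show ?case by simp
next
  case (Cons e es)
  let ?P = "\<lambda>es. (\<Prod>a\<leftarrow>es. [:- a, 1::complex:])"
  have nz: "?P es \<noteq> 0" for es
    by (induction es) (auto simp del: mult_pCons_left)
  have fin: "finite {x. poly (?P es) x = 0}" for es
    using nz poly_roots_finite by blast
  have ord: "Polynomial.order x (?P (e # es)) = (if x = e then 1 else 0) + Polynomial.order x (?P es)" for x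
    using nz[of "e # es"] order_linear[of e] order_0I[of "[:- e, 1:]" x]
    by (auto simp: order_mult simp del: mult_pCons_left)
  have roots: "{x. poly (?P (e # es)) x = 0} = insert e {x. poly (?P es) x = 0}"
    by (auto simp: algebra_simps)
  let ?R = "insert e {x. poly (?P es) x = 0}"
  have "(\<Sum>x\<in>?R. real (Polynomial.order x (?P (e # es))) * h x) =
     (\<Sum>x\<in>?R. (if x = e then h x else 0)) + (\<Sum>x\<in>?R. real (Polynomial.order x (?P es)) * h x)"
    unfolding ord sum.distrib[symmetric] by (intro sum.cong) (auto simp: algebra_simps)
  also have "(\<Sum>x\<in>?R. (if x = e then h x else 0)) = h e"
    using fin[of es] by (simp add: sum.delta)
  also have "(\<Sum>x\<in>?R. real (Polynomial.order x (?P es)) * h x) =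
     (\<Sum>x\<in>{x. poly (?P es) x = 0}. real (Polynomial.order x (?P es)) * h x)"
    by (rule sum.mono_neutral_right) (use fin nz in \<open>auto simp: order_root\<close>)
  finally show ?case unfolding roots Cons.IH by simp
qed

lemma trace_similar:
  fixes A B :: "'a::comm_ring_1 mat"
  assumes "A \<in> carrier_mat n n" "similar_mat A B"
  shows "(\<Sum>i<n. A $$ (i,i)) = (\<Sum>i<n. B $$ (i,i))"
proof -
  obtain P Q where w: "similar_mat_wit A B P Q"
    using assms unfolding similar_mat_def by blast
  note s = similar_mat_witD2[OF assms(1) w]
  have sw: "(\<Sum>i<n. (X * Y) $$ (i,i)) = (\<Sum>i<n. (Y * X) $$ (i,i))"
    if "X \<in> carrier_mat n n" "Y \<in> carrier_mat n n" for X Y :: "'a mat"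
  proof -
    have "(\<Sum>i<n. (X * Y) $$ (i,i)) = (\<Sum>i<n. \<Sum>j<n. X $$ (i,j) * Y $$ (j,i))"
      using that by (auto simp: scalar_prod_def atLeast0LessThan intro!: sum.cong)
    also have "\<dots> = (\<Sum>i<n. \<Sum>j<n. Y $$ (i,j) * X $$ (j,i))"
      by (subst sum.swap) (simp add: mult.commute)
    also have "\<dots> = (\<Sum>i<n. (Y * X) $$ (i,i))"
      using that by (auto simp: scalar_prod_def atLeast0LessThan intro!: sum.cong)
    finally show ?thesis .
  qed
  have "(\<Sum>i<n. A $$ (i,i)) = (\<Sum>i<n. (Q * (P * B)) $$ (i,i))"
    using s sw[of "P * B" Q] by auto
  also have "Q * (P * B) = B"
    using s assoc_mult_mat[of Q n n P n B n] by simp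
  finally show ?thesis .
qed

text \<open>Schur triangularisation: the diagonal of a similar triangular matrix carries both the
  characteristic polynomial and the trace.\<close>

lemma char_poly_factorized_trace:
  fixes A :: "complex mat"
  assumes A: "A \<in> carrier_mat n n"
  obtains es where "char_poly A = (\<Prod>a\<leftarrow>es. [:- a, 1:])" "sum_list es = (\<Sum>i<n. A $$ (i,i))"
proof -
  obtain as where as: "char_poly A = (\<Prod>a\<leftarrow>as. [:- a, 1:])"
    using char_poly_factorized[OF A] by blast
  obtain B where B: "B \<in> carrier_mat n n" "upper_triangular B" "similar_mat A B"
    using schur_decomposition_exists[OF A as] by blast
  have "char_poly A = (\<Prod>a\<leftarrow>diag_mat B. [:- a, 1:])"
    using char_poly_similar[OF B(3)] char_poly_upper_triangular[OF B(1,2)] by simp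
  moreover have "sum_list (diag_mat B) = (\<Sum>i<n. A $$ (i,i))"
    using trace_similar[OF A B(3)] B(1)
    by (simp add: diag_mat_def sum_list_sum_nth atLeast0LessThan)
  ultimately show thesis using that by blast
qed

section \<open>Eigenvalues of Gram matrices as seen by functions on the index set\<close>

lemma enum_set:
  assumes "finite F"
  shows "distinct (enum_set F)" "set (enum_set F) = F"
  using someI_ex[of "\<lambda>xs. distinct xs \<and> set xs = F"] finite_distinct_list[OF assms]
  unfolding enum_set_def by blast+

lemma sum_enum_set:
  assumes "finite F"
  shows "(\<Sum>i<length (enum_set F). h (enum_set F ! i)) = (\<Sum>x\<in>F. h x)"
  using sum.reindex_bij_betw[OF bij_betw_nth[of "enum_set F" "{..<length (enum_set F)}" F], of h]
    enum_set[OF assms] by simp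

lemma idx_gram_carrier:
  "gram_mat (idx_mat F T) \<in> carrier_mat (length (enum_set F)) (length (enum_set F))"
  unfolding gram_mat_def idx_mat_def Let_def by simp

lemma idx_gram_index:
  assumes "finite F" "i < length (enum_set F)" "j < length (enum_set F)"
  shows "gram_mat (idx_mat F T) $$ (i,j) =
    (\<Sum>x\<in>F. cnj (T x (enum_set F ! i)) * T x (enum_set F ! j))"
  using assms sum_enum_set[OF assms(1), of "\<lambda>x. cnj (T x (enum_set F ! i)) * T x (enum_set F ! j)"]
  unfolding gram_mat_def idx_mat_def Let_def by simp

lemma mult_mat_vec_index_sum:
  assumes "A \<in> carrier_mat n n" "v \<in> carrier_vec n" "i < n"
  shows "(A *\<^sub>v v) $ i = (\<Sum>j<n. A $$ (i,j) * v $ j)"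
  using assms by (auto simp: scalar_prod_def atLeast0LessThan intro!: sum.cong)

text \<open>Transports an eigenvector to a function on \<open>F\<close>, so that the eigenvalue
  estimates do not see the ordering chosen by \<open>enum_set\<close>.\<close>

lemma gram_eigenvalueE:
  assumes F: "finite F" and root: "poly (char_poly (gram_mat (idx_mat F T))) z = 0"
  obtains v y0 where "y0 \<in> F" "v y0 \<noteq> 0"
    "\<And>y. y \<in> F \<Longrightarrow> (\<Sum>y'\<in>F. (\<Sum>x\<in>F. cnj (T x y) * T x y') * v y') = z * v y"
proof -
  let ?xs = "enum_set F" let ?n = "length ?xs" let ?G = "gram_mat (idx_mat F T)"
  note G = idx_gram_carrier[of F T]
  have "eigenvalue ?G z" using eigenvalue_root_char_poly[OF G] root by simp
  then obtain w where w: "w \<in> carrier_vec ?n" "w \<noteq> 0\<^sub>v ?n" "?G *\<^sub>v w = z \<cdot>\<^sub>v w"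
    unfolding eigenvalue_def eigenvector_def using G by auto
  have bij: "bij_betw ((!) ?xs) {..<?n} F"
    using enum_set[OF F] by (intro bij_betw_nth) auto
  define v where "v y = w $ (the_inv_into {..<?n} ((!) ?xs) y)" for y
  have v: "v (?xs ! i) = w $ i" if "i < ?n" for i
    unfolding v_def using that bij by (simp add: bij_betw_def the_inv_into_f_f)
  obtain i0 where i0: "i0 < ?n" "w $ i0 \<noteq> 0" using w(1,2) by (metis carrier_vecD dim_vec eq_vecI index_zero_vec(1) index_zero_vec(2))
  show thesis
  proof (rule that[of "?xs ! i0" v])
    show "?xs ! i0 \<in> F" using i0 enum_set[OF F] nth_mem by blast
    show "v (?xs ! i0) \<noteq> 0" using i0 v by simp
    fix y assume "y \<in> F"
    then obtain i where i: "i < ?n" "y = ?xs ! i" using bij by (auto simp: bij_betw_def)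
    have "(\<Sum>y'\<in>F. (\<Sum>x\<in>F. cnj (T x y) * T x y') * v y') =
      (\<Sum>j<?n. ?G $$ (i,j) * w $ j)"
      by (subst sum_enum_set[OF F, symmetric]) (auto simp: idx_gram_index[OF F] i v intro!: sum.cong)
    also have "\<dots> = (?G *\<^sub>v w) $ i" using mult_mat_vec_index_sum[OF G w(1) i(1)] by simp
    also have "\<dots> = z * v y" using w i v by simp
    finally show "(\<Sum>y'\<in>F. (\<Sum>x\<in>F. cnj (T x y) * T x y') * v y') = z * v y" .
  qed
qed

lemma gram_eigenvalueI:
  assumes F: "finite F" and "y0 \<in> F" "v y0 \<noteq> 0"
    "\<And>y. y \<in> F \<Longrightarrow> (\<Sum>y'\<in>F. (\<Sum>x\<in>F. cnj (T x y) * T x y') * v y') = z * v y"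
  shows "poly (char_poly (gram_mat (idx_mat F T))) z = 0"
proof -
  let ?xs = "enum_set F" let ?n = "length ?xs" let ?G = "gram_mat (idx_mat F T)"
  note G = idx_gram_carrier[of F T]
  let ?w = "vec ?n (\<lambda>i. v (?xs ! i))"
  obtain i0 where i0: "i0 < ?n" "y0 = ?xs ! i0" using enum_set(2)[OF F] assms(2)
    by (metis in_set_conv_nth)
  have "?w $ i0 \<noteq> 0\<^sub>v ?n $ i0" using i0 assms by simp
  hence nz: "?w \<noteq> 0\<^sub>v ?n" by metis
  have "?G *\<^sub>v ?w = z \<cdot>\<^sub>v ?w"
  proof (rule eq_vecI)
    fix i assume "i < dim_vec (z \<cdot>\<^sub>v ?w)"
    hence i: "i < ?n" by simp
    have "(?G *\<^sub>v ?w) $ i = (\<Sum>j<?n. ?G $$ (i,j) * v (?xs ! j))"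
      using mult_mat_vec_index_sum[OF G _ i, of ?w] by simp
    also have "\<dots> = (\<Sum>y'\<in>F. (\<Sum>x\<in>F. cnj (T x (?xs ! i)) * T x y') * v y')"
      by (subst (2) sum_enum_set[OF F, symmetric]) (auto simp: idx_gram_index[OF F] i intro!: sum.cong)
    also have "\<dots> = z * v (?xs ! i)" using assms(4) i enum_set(2)[OF F] nth_mem by blast
    finally show "(?G *\<^sub>v ?w) $ i = (z \<cdot>\<^sub>v ?w) $ i" using i by simp
  qed (use G in auto)
  hence "eigenvalue ?G z"
    unfolding eigenvalue_def eigenvector_def using G nz by (intro exI[of _ ?w]) auto
  thus ?thesis using eigenvalue_root_char_poly[OF G] by simp
qed

text \<open>Pairing the eigenvector equation with \<open>v\<close> gives \<open>z\<close> times the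
  squared norm of \<open>v\<close> on one side and the squared norm of \<open>T v\<close> on the
  other.\<close>

lemma gram_eigenvalue_nonneg:
  assumes F: "finite F" and root: "poly (char_poly (gram_mat (idx_mat F T))) z = 0"
  shows "z = complex_of_real (cmod z)"
proof -
  obtain v y0 where v: "y0 \<in> F" "v y0 \<noteq> 0"
    "\<And>y. y \<in> F \<Longrightarrow> (\<Sum>y'\<in>F. (\<Sum>x\<in>F. cnj (T x y) * T x y') * v y') = z * v y"
    using gram_eigenvalueE[OF F root] by blast
  define N where "N = (\<Sum>y\<in>F. (cmod (v y))\<^sup>2)"
  define K where "K = (\<Sum>x\<in>F. (cmod (\<Sum>y\<in>F. T x y * v y))\<^sup>2)"
  have "N > 0" unfolding N_def using v F by (intro sum_pos2[of F y0]) auto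
  have "z * complex_of_real N = (\<Sum>y\<in>F. cnj (v y) * (z * v y))"
    unfolding N_def of_real_sum complex_norm_square
    by (simp add: sum_distrib_left mult_ac)
  also have "\<dots> = (\<Sum>y\<in>F. cnj (v y) * (\<Sum>y'\<in>F. (\<Sum>x\<in>F. cnj (T x y) * T x y') * v y'))"
    using v(3) by simp
  also have "\<dots> = (\<Sum>y\<in>F. \<Sum>y'\<in>F. \<Sum>x\<in>F. (T x y' * v y') * cnj (T x y * v y))"
    by (simp add: sum_distrib_left sum_distrib_right mult_ac)
  also have "\<dots> = (\<Sum>x\<in>F. \<Sum>y\<in>F. \<Sum>y'\<in>F. (T x y' * v y') * cnj (T x y * v y))"
    by (subst (2) sum.swap, subst sum.swap) (rule refl)
  also have "\<dots> = complex_of_real K"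
    unfolding K_def of_real_sum complex_norm_square cnj_sum sum_product
    by (rule sum.cong, rule refl, rule sum.swap)
  finally have zK: "z * complex_of_real N = complex_of_real K" .
  hence "z = complex_of_real (K / N)" using \<open>N > 0\<close> by (simp add: field_simps)
  moreover have "K / N \<ge> 0" using \<open>N > 0\<close> unfolding K_def by (simp add: sum_nonneg)
  ultimately show ?thesis by (metis norm_of_real abs_of_nonneg)
qed

text \<open>Read the eigenvector equation at a coordinate where \<open>v\<close> has maximal
  modulus. Row sums thus control the square of the operator norm of \<open>T\<close>.\<close>

lemma gram_eigenvalue_le_row_sum:
  assumes F: "finite F" and root: "poly (char_poly (gram_mat (idx_mat F T))) z = 0"
    and R: "\<And>y. y \<in> F \<Longrightarrow> (\<Sum>y'\<in>F. cmod (\<Sum>x\<in>F. cnj (T x y) * T x y')) \<le> R"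
  shows "cmod z \<le> R"
proof -
  obtain v y0 where v: "y0 \<in> F" "v y0 \<noteq> 0"
    "\<And>y. y \<in> F \<Longrightarrow> (\<Sum>y'\<in>F. (\<Sum>x\<in>F. cnj (T x y) * T x y') * v y') = z * v y"
    using gram_eigenvalueE[OF F root] by blast
  have "Max ((\<lambda>y. cmod (v y)) ` F) \<in> (\<lambda>y. cmod (v y)) ` F"
    using F v(1) by (intro Max_in) auto
  then obtain y1 where y1: "y1 \<in> F" "cmod (v y1) = Max ((\<lambda>y. cmod (v y)) ` F)" by auto
  have le: "cmod (v y) \<le> cmod (v y1)" if "y \<in> F" for y
    unfolding y1(2) using F that by (intro Max_ge) auto
  have pos: "cmod (v y1) > 0" using le[OF v(1)] v(2) by (meson less_le_trans zero_less_norm_iff)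
  have "cmod z * cmod (v y1) = cmod (\<Sum>y'\<in>F. (\<Sum>x\<in>F. cnj (T x y1) * T x y') * v y')"
    using v(3)[OF y1(1)] by (simp add: norm_mult)
  also have "\<dots> \<le> (\<Sum>y'\<in>F. cmod (\<Sum>x\<in>F. cnj (T x y1) * T x y') * cmod (v y1))"
    by (rule sum_norm_le) (auto simp: norm_mult intro!: mult_left_mono le)
  also have "\<dots> \<le> R * cmod (v y1)"
    using R[OF y1(1)] by (simp add: sum_distrib_right[symmetric] mult_right_mono)
  finally show ?thesis using pos by simp
qed

text \<open>Interpolates between the operator norm and the Hilbert-Schmidt norm: \<open>R\<close>
  bounds every eigenvalue of the Gram matrix, and the eigenvalues sum to its trace.\<close>

lemma schatten_norm_le:
  assumes F: "finite F" and p: "p \<ge> 2"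
    and R: "\<And>y. y \<in> F \<Longrightarrow> (\<Sum>y'\<in>F. cmod (\<Sum>x\<in>F. cnj (T x y) * T x y')) \<le> R"
  shows "schatten_norm p F T \<le> (R powr (p/2 - 1) * (\<Sum>y\<in>F. \<Sum>x\<in>F. (cmod (T x y))\<^sup>2)) powr (1/p)"
proof -
  let ?n = "length (enum_set F)" let ?G = "gram_mat (idx_mat F T)"
  obtain es where es: "char_poly ?G = (\<Prod>a\<leftarrow>es. [:- a, 1:])" "sum_list es = (\<Sum>i<?n. ?G $$ (i,i))"
    using char_poly_factorized_trace[OF idx_gram_carrier] by blast
  have root: "poly (char_poly ?G) z = 0" if "z \<in> set es" for z
    using that unfolding es(1) by (induction es) auto
  have re: "z = complex_of_real (cmod z)" if "z \<in> set es" for z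
    using gram_eigenvalue_nonneg[OF F root[OF that]] .
  have "complex_of_real (sum_list (map cmod es)) = sum_list es"
    using re by (induction es) auto
  also have "\<dots> = (\<Sum>y\<in>F. \<Sum>x\<in>F. cnj (T x y) * T x y)"
    unfolding es(2) by (subst sum_enum_set[OF F, symmetric]) (auto simp: idx_gram_index[OF F])
  also have "\<dots> = complex_of_real (\<Sum>y\<in>F. \<Sum>x\<in>F. (cmod (T x y))\<^sup>2)"
    unfolding of_real_sum complex_norm_square by (simp add: mult.commute)
  finally have tr: "sum_list (map cmod es) = (\<Sum>y\<in>F. \<Sum>x\<in>F. (cmod (T x y))\<^sup>2)"
    by (simp only: of_real_eq_iff)
  \<comment> \<open>Bound the power \<open>p/2 - 1\<close> of each eigenvalue by that of
    \<open>R\<close>, which is monotone because \<open>p \<ge> 2\<close>, and keep one factor for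
    the trace.\<close>
  have "sum_list (map (\<lambda>z. cmod z powr (p/2)) es) \<le> sum_list (map (\<lambda>z. R powr (p/2-1) * cmod z) es)"
  proof (rule sum_list_mono)
    fix z assume z: "z \<in> set es"
    have le: "cmod z \<le> R" using gram_eigenvalue_le_row_sum[OF F root[OF z] R] by simp
    have "cmod z powr (p/2) = cmod z powr (p/2 - 1) * cmod z"
      by (cases "z = 0") (auto simp: powr_diff)
    also have "\<dots> \<le> R powr (p/2 - 1) * cmod z"
      using le p by (intro mult_right_mono powr_mono2) auto
    finally show "cmod z powr (p/2) \<le> R powr (p/2-1) * cmod z" .
  qed
  also have "\<dots> = R powr (p/2-1) * (\<Sum>y\<in>F. \<Sum>x\<in>F. (cmod (T x y))\<^sup>2)"
    unfolding tr[symmetric] by (simp add: sum_list_const_mult)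
  finally have le: "sum_list (map (\<lambda>z. cmod z powr (p/2)) es) \<le> \<dots>" .
  have "schatten_norm p F T = sum_list (map (\<lambda>z. cmod z powr (p/2)) es) powr (1/p)"
    unfolding schatten_norm_def Let_def es(1) sum_roots_prod_list_linear[of es "\<lambda>z. cmod z powr (p/2)"] ..
  also have "\<dots> \<le> (R powr (p/2 - 1) * (\<Sum>y\<in>F. \<Sum>x\<in>F. (cmod (T x y))\<^sup>2)) powr (1/p)"
    using p le by (intro powr_mono2) (auto intro!: sum_list_nonneg)
  finally show ?thesis .
qed

text \<open>One singular value is at most the whole norm; this is meant for an explicit
  eigenvector.\<close>

lemma schatten_norm_ge:
  assumes F: "finite F" and p: "p > 0" and "y0 \<in> F" "v y0 \<noteq> 0"
    "\<And>y. y \<in> F \<Longrightarrow> (\<Sum>y'\<in>F. (\<Sum>x\<in>F. cnj (T x y) * T x y') * v y') = z * v y"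
  shows "sqrt (cmod z) \<le> schatten_norm p F T"
proof -
  let ?P = "char_poly (gram_mat (idx_mat F T))"
  have root: "poly ?P z = 0" using gram_eigenvalueI[where T = T and v = v, OF F assms(3-5)] .
  have nz: "?P \<noteq> 0"
    using degree_monic_char_poly[OF idx_gram_carrier, of F T] by auto
  have "1 * cmod z powr (p/2) \<le> real (Polynomial.order z ?P) * cmod z powr (p/2)"
    using root nz by (intro mult_right_mono) (auto simp: order_root Suc_le_eq)
  also have "\<dots> \<le> (\<Sum>x\<in>{x. poly ?P x = 0}. real (Polynomial.order x ?P) * cmod x powr (p/2))"
    using nz root by (intro member_le_sum) (auto intro: poly_roots_finite)
  finally have "(cmod z powr (p/2)) powr (1/p) \<le> schatten_norm p F T"
    unfolding schatten_norm_def Let_def using p by (intro powr_mono2) auto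
  thus ?thesis using p by (simp add: powr_powr powr_half_sqrt)
qed

lemma schatten_norm_nonneg: "schatten_norm p F T \<ge> 0"
  unfolding schatten_norm_def Let_def by simp

section \<open>Differences of uniform measures on polynomials\<close>

text \<open>Stated through coefficients because \<open>degree 0 = 0\<close>: each set is then a
  subspace of dimension \<open>k\<close>, with the zero polynomial included even for
  \<open>k = 0\<close>.\<close>

definition polys_lt :: "nat \<Rightarrow> 'k::zero poly set" where
  "polys_lt k = {p. \<forall>i\<ge>k. coeff p i = 0}"

lemma polys_lt_iff_degree: "p \<in> polys_lt k \<longleftrightarrow> p = 0 \<or> degree p < k"
proof (cases "p = 0")
  case False
  have "degree p < k" if "\<forall>i\<ge>k. coeff p i = 0"
    using that False leading_coeff_0_iff[of p] by (meson not_less)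
  thus ?thesis using False by (auto simp: polys_lt_def coeff_eq_0)
qed (simp add: polys_lt_def)

lemma polys_lt_mono: "k \<le> l \<Longrightarrow> polys_lt k \<subseteq> polys_lt l"
  unfolding polys_lt_def by auto

lemma zero_in_polys_lt [simp]: "0 \<in> polys_lt k"
  unfolding polys_lt_def by simp

lemma polys_lt_add: "p \<in> polys_lt k \<Longrightarrow> r \<in> polys_lt k \<Longrightarrow> p + r \<in> polys_lt k"
  for p r :: "'k::comm_ring_1 poly"
  unfolding polys_lt_def by simp

lemma polys_lt_diff: "p \<in> polys_lt k \<Longrightarrow> r \<in> polys_lt k \<Longrightarrow> p - r \<in> polys_lt k"
  for p r :: "'k::comm_ring_1 poly"
  unfolding polys_lt_def by simp

lemma polys_lt_uminus: "p \<in> polys_lt k \<Longrightarrow> - p \<in> polys_lt k"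
  for p :: "'k::comm_ring_1 poly"
  unfolding polys_lt_def by simp

lemma polys_lt_mult:
  fixes p r :: "'k::idom poly"
  assumes "p \<in> polys_lt k" "r \<in> polys_lt l"
  shows "p * r \<in> polys_lt (k + l)"
  using assms by (cases "p = 0 \<or> r = 0") (auto simp: polys_lt_iff_degree degree_mult_eq)

lemma finite_card_polys_lt:
  "finite (polys_lt k :: 'k::{finite,field} poly set) \<and>
   card (polys_lt k :: 'k poly set) = CARD('k) ^ k"
proof (induction k)
  case 0
  have "polys_lt 0 = {0 :: 'k poly}" unfolding polys_lt_def by (auto simp: poly_eq_iff)
  thus ?case by simp
next
  case (Suc k)
  have eq: "polys_lt (Suc k) = (\<lambda>(a, p). pCons a p) ` (UNIV \<times> (polys_lt k :: 'k poly set))"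
  proof (intro equalityI subsetI)
    fix p :: "'k poly" assume p: "p \<in> polys_lt (Suc k)"
    obtain a r where "p = pCons a r" by (cases p)
    thus "p \<in> (\<lambda>(a, p). pCons a p) ` (UNIV \<times> polys_lt k)"
      using p unfolding polys_lt_def by (fastforce simp: coeff_pCons)
  qed (auto simp: polys_lt_def coeff_pCons split: nat.split)
  have inj: "inj_on (\<lambda>(a, p). pCons a p) (UNIV \<times> (polys_lt k :: 'k poly set))"
    by (auto simp: inj_on_def)
  show ?case unfolding eq using Suc by (simp add: card_image[OF inj] card_cartesian_product)
qed

lemmas finite_polys_lt [simp] = finite_card_polys_lt[THEN conjunct1]
lemmas card_polys_lt = finite_card_polys_lt[THEN conjunct2]

lemma sum_polys_lt_shift:
  fixes v :: "'k::{finite,field} poly"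
  assumes "v \<in> polys_lt k"
  shows "(\<Sum>b\<in>polys_lt k. h (b + v)) = (\<Sum>u\<in>polys_lt k. h u)"
  by (rule sum.reindex_bij_witness[of _ "\<lambda>u. u - v" "\<lambda>b. b + v"])
     (use assms in \<open>auto intro: polys_lt_add polys_lt_diff\<close>)

text \<open>Divide \<open>v\<close> by \<open>\<gamma>\<close>. The remainder already lies in
  \<open>polys_lt k\<close>, so only \<open>(a + a0) * \<gamma>\<close> is constrained, and
  \<open>a + a0\<close> ranges over a subspace of dimension
  \<open>k - degree \<gamma>\<close>.\<close>

lemma card_affine_polys_lt:
  fixes v \<gamma> :: "'k::{finite,field} poly"
  assumes \<gamma>: "\<gamma> \<noteq> 0" "degree \<gamma> \<le> k" "k \<le> n + degree \<gamma>"
  shows "card {a \<in> polys_lt n. v + a * \<gamma> \<in> polys_lt k} =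
    (if v \<in> polys_lt (n + degree \<gamma>) then CARD('k) ^ (k - degree \<gamma>) else 0)"
proof -
  let ?m = "degree \<gamma>"
  have mult_iff: "a * \<gamma> \<in> polys_lt (l + ?m) \<longleftrightarrow> a \<in> polys_lt l" for a l
    using \<gamma>(1) by (cases "a = 0") (auto simp: polys_lt_iff_degree degree_mult_eq)
  show ?thesis
  proof (cases "v \<in> polys_lt (n + ?m)")
    case True
    define a0 where "a0 = v div \<gamma>"
    define r where "r = v mod \<gamma>"
    have v: "v = a0 * \<gamma> + r" unfolding a0_def r_def by simp
    have r: "r \<in> polys_lt ?m"
      unfolding r_def polys_lt_iff_degree using degree_mod_less[OF \<gamma>(1), of v] by blast
    have "r \<in> polys_lt (n + ?m)" using r polys_lt_mono[of ?m "n + ?m"] by auto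
    hence "v - r \<in> polys_lt (n + ?m)" using True polys_lt_diff by blast
    hence "a0 * \<gamma> \<in> polys_lt (n + ?m)" unfolding v by simp
    hence a0: "a0 \<in> polys_lt n" by (simp add: mult_iff)
    obtain l where l: "k = l + ?m" "l \<le> n" using \<gamma> by (metis add.commute le_Suc_ex nat_add_left_cancel_le)
    have rk: "r \<in> polys_lt k" using r polys_lt_mono[OF \<gamma>(2)] by auto
    have iff: "v + a * \<gamma> \<in> polys_lt k \<longleftrightarrow> a + a0 \<in> polys_lt l" for a
    proof -
      have "v + a * \<gamma> \<in> polys_lt k \<longleftrightarrow> (a + a0) * \<gamma> \<in> polys_lt k"
        using polys_lt_add[of "(a + a0) * \<gamma>" k r] polys_lt_diff[of "v + a * \<gamma>" k r] rk
        unfolding v by (auto simp: algebra_simps)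
      thus ?thesis unfolding l(1) mult_iff .
    qed
    have "bij_betw (\<lambda>a. a + a0) {a \<in> polys_lt n. v + a * \<gamma> \<in> polys_lt k} (polys_lt l)"
      by (rule bij_betwI[where g = "\<lambda>b. b - a0"])
         (use a0 polys_lt_mono[OF l(2)] in \<open>auto simp: iff intro!: polys_lt_diff\<close>)
    hence "card {a \<in> polys_lt n. v + a * \<gamma> \<in> polys_lt k} = card (polys_lt l :: 'k poly set)"
      by (rule bij_betw_same_card)
    thus ?thesis using True l by (simp add: card_polys_lt)
  next
    case False
    have "v + a * \<gamma> \<notin> polys_lt k" if "a \<in> polys_lt n" for a
    proof
      assume "v + a * \<gamma> \<in> polys_lt k"
      hence "v + a * \<gamma> - a * \<gamma> \<in> polys_lt (n + ?m)"
        using polys_lt_mono[OF \<gamma>(3)] that by (intro polys_lt_diff) (auto simp: mult_iff)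
      thus False using False by simp
    qed
    hence "{a \<in> polys_lt n. v + a * \<gamma> \<in> polys_lt k} = {}" by auto
    thus ?thesis using False by (simp only: card.empty if_False)
  qed
qed

text \<open>\<open>(q - 1) * q ^ k\<close> counts the polynomials of degree exactly
  \<open>k\<close>; for \<open>k = 0\<close> these are the nonzero constants.\<close>

definition unif_deg :: "nat \<Rightarrow> 'k::{finite,field} poly \<Rightarrow> real" where
  "unif_deg k u = (if u \<in> polys_lt (Suc k) - polys_lt k
     then 1 / ((real CARD('k) - 1) * real CARD('k) ^ k) else 0)"

lemma two_le_card_field: "2 \<le> real CARD('k::{finite,field})"
proof -
  have "card {0, 1 :: 'k} \<le> CARD('k)" by (rule card_mono) auto
  thus ?thesis by simp
qed

lemma unif_deg_nonneg: "0 \<le> unif_deg k u"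
  for u :: "'k::{finite,field} poly"
  using two_le_card_field[where 'k='k] unfolding unif_deg_def by simp

lemma unif_deg_le: "unif_deg k u \<le> 1 / real CARD('k) ^ k"
  for u :: "'k::{finite,field} poly"
proof -
  have "1 * real CARD('k) ^ k \<le> (real CARD('k) - 1) * real CARD('k) ^ k"
    using two_le_card_field[where 'k='k] by (intro mult_right_mono) auto
  thus ?thesis using two_le_card_field[where 'k='k]
    unfolding unif_deg_def by (auto intro!: divide_left_mono)
qed

lemma unif_deg_conv_indicator:
  fixes u :: "'k::{finite,field} poly"
  shows "unif_deg k u = (of_bool (u \<in> polys_lt (Suc k)) - of_bool (u \<in> polys_lt k)) /
    ((real CARD('k) - 1) * real CARD('k) ^ k)"
  using polys_lt_mono[of k "Suc k"] unfolding unif_deg_def by auto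

lemma sum_of_bool_card: "finite A \<Longrightarrow> (\<Sum>a\<in>A. of_bool (Q a)) = real (card {a \<in> A. Q a})"
  by (simp add: Int_def)

lemma sum_unif_deg:
  assumes "k < N"
  shows "(\<Sum>u\<in>polys_lt N. unif_deg k (u :: 'k::{finite,field} poly)) = 1"
proof -
  have c: "(\<Sum>u\<in>polys_lt N. of_bool ((u :: 'k poly) \<in> polys_lt l)) = real CARD('k) ^ l" if "l \<le> N" for l
  proof -
    have "{u \<in> polys_lt N. (u :: 'k poly) \<in> polys_lt l} = polys_lt l"
      using polys_lt_mono[OF that] by auto
    thus ?thesis by (simp add: sum_of_bool_card card_polys_lt del: sum_of_bool_eq)
  qed
  show ?thesis
    using assms two_le_card_field[where 'k='k]
    unfolding unif_deg_conv_indicator sum_divide_distrib[symmetric] sum_subtractf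
    by (simp add: c algebra_simps del: sum_of_bool_eq)
qed

text \<open>The point is that the value does not involve \<open>k\<close>: along the line in
  direction \<open>\<gamma>\<close>, the uniform measures of different degrees become
  indistinguishable.\<close>

lemma sum_unif_deg_affine:
  fixes v \<gamma> :: "'k::{finite,field} poly"
  assumes \<gamma>: "\<gamma> \<noteq> 0" "degree \<gamma> \<le> k" "k < n + degree \<gamma>"
  shows "(\<Sum>a\<in>polys_lt n. unif_deg k (v + a * \<gamma>)) =
    (if v \<in> polys_lt (n + degree \<gamma>) then 1 / real CARD('k) ^ degree \<gamma> else 0)"
proof -
  let ?q = "real CARD('k)"
  have "(\<Sum>a\<in>polys_lt n. unif_deg k (v + a * \<gamma>)) =
    (if v \<in> polys_lt (n + degree \<gamma>) then (?q ^ (Suc k - degree \<gamma>) - ?q ^ (k - degree \<gamma>)) /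
      ((?q - 1) * ?q ^ k) else 0)"
    using \<gamma> card_affine_polys_lt[of \<gamma> "Suc k" n v] card_affine_polys_lt[of \<gamma> k n v]
    unfolding unif_deg_conv_indicator sum_divide_distrib[symmetric] sum_subtractf
    by (simp add: sum_of_bool_card del: sum_of_bool_eq)
  moreover have "(?q ^ (Suc k - degree \<gamma>) - ?q ^ (k - degree \<gamma>)) / ((?q - 1) * ?q ^ k) = 1 / ?q ^ degree \<gamma>"
  proof -
    obtain l where l: "k = degree \<gamma> + l" using \<gamma>(2) le_Suc_ex by blast
    show ?thesis using two_le_card_field[where 'k='k] unfolding l
      by (simp add: field_simps power_add Suc_diff_le)
  qed
  ultimately show ?thesis by simp
qed

definition deg_diff :: "nat \<Rightarrow> 'k::{finite,field} poly \<Rightarrow> real" where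
  "deg_diff n u = unif_deg n u - unif_deg (Suc n) u"

lemma sum_abs_deg_diff:
  assumes "Suc n < N"
  shows "(\<Sum>u\<in>polys_lt N. \<bar>deg_diff n (u :: 'k::{finite,field} poly)\<bar>) \<le> 2"
proof -
  have "(\<Sum>u\<in>polys_lt N. \<bar>deg_diff n (u :: 'k poly)\<bar>) \<le>
    (\<Sum>u\<in>polys_lt N. unif_deg n (u :: 'k poly) + unif_deg (Suc n) u)"
    unfolding deg_diff_def
    by (intro sum_mono) (use unif_deg_nonneg in \<open>smt (verit)\<close>)
  also have "\<dots> = 2" using assms by (simp add: sum.distrib sum_unif_deg)
  finally show ?thesis .
qed

text \<open>The sup norm is at most \<open>1 / q ^ n\<close> and the l1 norm at most 2; multiply the
  two.\<close>

lemma sum_deg_diff_square: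
  assumes "Suc n < N"
  shows "(\<Sum>u\<in>polys_lt N. (deg_diff n (u :: 'k::{finite,field} poly))\<^sup>2) \<le> 2 / real CARD('k) ^ n"
proof -
  let ?q = "real CARD('k)"
  have le: "\<bar>deg_diff n u\<bar> \<le> 1 / ?q ^ n" for u :: "'k poly"
  proof -
    have "1 / ?q ^ Suc n \<le> 1 / ?q ^ n"
      using two_le_card_field[where 'k='k] by (intro divide_left_mono power_increasing) auto
    thus ?thesis
      using unif_deg_le[of n u] unif_deg_le[of "Suc n" u] unif_deg_nonneg[of n u]
        unif_deg_nonneg[of "Suc n" u] unfolding deg_diff_def by linarith
  qed
  have "(\<Sum>u\<in>polys_lt N. (deg_diff n (u :: 'k poly))\<^sup>2) \<le>
    (\<Sum>u\<in>polys_lt N. 1 / ?q ^ n * \<bar>deg_diff n (u :: 'k poly)\<bar>)"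
  proof (rule sum_mono)
    fix u :: "'k poly"
    have "(deg_diff n u)\<^sup>2 = \<bar>deg_diff n u\<bar> * \<bar>deg_diff n u\<bar>"
      by (simp add: power2_eq_square)
    also have "\<dots> \<le> 1 / ?q ^ n * \<bar>deg_diff n u\<bar>" by (rule mult_right_mono[OF le]) simp
    finally show "(deg_diff n u)\<^sup>2 \<le> 1 / ?q ^ n * \<bar>deg_diff n u\<bar>" .
  qed
  also have "\<dots> \<le> 1 / ?q ^ n * 2"
    unfolding sum_distrib_left[symmetric]
    by (rule mult_left_mono[OF sum_abs_deg_diff[OF assms]]) simp
  finally show ?thesis by simp
qed

text \<open>The two measures cancel by \<open>sum_unif_deg_affine\<close>. Degree at least 2 is what
  its hypothesis \<open>k < n + degree \<gamma>\<close> demands for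
  \<open>k = Suc n\<close>.\<close>

lemma sum_deg_diff_affine:
  fixes v \<gamma> :: "'k::{finite,field} poly"
  assumes "\<gamma> \<in> polys_lt n" "\<gamma> \<notin> polys_lt 2"
  shows "(\<Sum>a\<in>polys_lt n. deg_diff n (v + a * \<gamma>)) = 0"
proof -
  have "\<gamma> \<noteq> 0" "2 \<le> degree \<gamma>" "degree \<gamma> < n" using assms by (auto simp: polys_lt_iff_degree)
  thus ?thesis unfolding deg_diff_def sum_subtractf by (simp add: sum_unif_deg_affine)
qed

section \<open>Schatten norms of matrices indexed by the Heisenberg group\<close>

text \<open>The matrices \<open>T\<close> below live on a finite set \<open>F\<close> containing two copies, by \<open>\<xi>\<close> and \<open>\<eta>\<close>,
  of \<open>polys_lt n \<times> polys_lt (2 * n)\<close>, with \<open>(\<xi> (a, b), \<eta> (c, d))\<close>-entry depending only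
  on the central coordinate \<open>b + d + a * c\<close> of a product in the Heisenberg group.\<close>

locale bilinear_index =
  fixes n :: nat and F :: "'a set" and \<xi> \<eta> :: "'k::{finite,field} poly \<times> 'k poly \<Rightarrow> 'a"
    and T :: "'a \<Rightarrow> 'a \<Rightarrow> complex"
  assumes n: "2 \<le> n" and F: "finite F"
    and inj: "inj_on \<xi> (polys_lt n \<times> polys_lt (2 * n))" "inj_on \<eta> (polys_lt n \<times> polys_lt (2 * n))"
    and sub: "\<xi> ` (polys_lt n \<times> polys_lt (2 * n)) \<subseteq> F" "\<eta> ` (polys_lt n \<times> polys_lt (2 * n)) \<subseteq> F"
    and zero_left: "\<And>x y. x \<notin> \<xi> ` (polys_lt n \<times> polys_lt (2 * n)) \<Longrightarrow> T x y = 0"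
    and zero_right: "\<And>x y. y \<notin> \<eta> ` (polys_lt n \<times> polys_lt (2 * n)) \<Longrightarrow> T x y = 0"
begin

lemma sum_left:
  fixes h :: "'a \<Rightarrow> 'b::comm_monoid_add"
  assumes "\<And>x. x \<notin> \<xi> ` (polys_lt n \<times> polys_lt (2 * n)) \<Longrightarrow> h x = 0"
  shows "(\<Sum>x\<in>F. h x) = (\<Sum>a\<in>polys_lt n. \<Sum>b\<in>polys_lt (2 * n). h (\<xi> (a, b)))"
proof -
  have "(\<Sum>x\<in>F. h x) = (\<Sum>x\<in>\<xi> ` (polys_lt n \<times> polys_lt (2 * n)). h x)"
    by (rule sum.mono_neutral_right) (use F sub assms in auto)
  thus ?thesis by (simp add: sum.reindex[OF inj(1)] sum.cartesian_product case_prod_unfold)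
qed

lemma sum_right:
  fixes h :: "'a \<Rightarrow> 'b::comm_monoid_add"
  assumes "\<And>x. x \<notin> \<eta> ` (polys_lt n \<times> polys_lt (2 * n)) \<Longrightarrow> h x = 0"
  shows "(\<Sum>x\<in>F. h x) = (\<Sum>a\<in>polys_lt n. \<Sum>b\<in>polys_lt (2 * n). h (\<eta> (a, b)))"
proof -
  have "(\<Sum>x\<in>F. h x) = (\<Sum>x\<in>\<eta> ` (polys_lt n \<times> polys_lt (2 * n)). h x)"
    by (rule sum.mono_neutral_right) (use F sub assms in auto)
  thus ?thesis by (simp add: sum.reindex[OF inj(2)] sum.cartesian_product case_prod_unfold)
qed

lemma mult_in_polys_lt: "a \<in> polys_lt n \<Longrightarrow> c \<in> polys_lt n \<Longrightarrow> a * c \<in> (polys_lt (2 * n) :: 'k poly set)"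
  using polys_lt_mult[of a n c n] by (simp add: mult_2)

lemma Suc_less_2n: "Suc n < 2 * n"
  using n by simp

text \<open>The reason for the range \<open>2 * n\<close> of the second coordinates: it contains
  every \<open>a * c\<close>, so that the sum over \<open>b\<close> is invariant under these
  translations.\<close>

lemma sum_polys_lt_center:
  fixes h :: "'k poly \<Rightarrow> 'b::comm_monoid_add"
  assumes "a \<in> polys_lt n" "c \<in> polys_lt n" "d \<in> polys_lt (2 * n)"
  shows "(\<Sum>b\<in>polys_lt (2 * n). h (b + d + a * c)) = (\<Sum>u\<in>polys_lt (2 * n). h u)"
  using sum_polys_lt_shift[of "d + a * c" "2 * n" h] assms
  by (simp add: add.assoc mult_in_polys_lt polys_lt_add)

text \<open>The indicator of the column copy is an eigenvector of the Gram matrix: on the copies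
  every row sum and every column sum of \<open>T\<close> is \<open>q ^ n * (z - w)\<close>. Here
  \<open>z\<close> and \<open>w\<close> stand for the values of the multiplier in degrees
  \<open>n\<close> and \<open>Suc n\<close>.\<close>

lemma schatten_norm_ge_deg_diff:
  fixes z w :: complex
  assumes T: "\<And>a b c d. a \<in> polys_lt n \<Longrightarrow> b \<in> polys_lt (2 * n) \<Longrightarrow> c \<in> polys_lt n \<Longrightarrow>
      d \<in> polys_lt (2 * n) \<Longrightarrow> T (\<xi> (a, b)) (\<eta> (c, d)) =
        z * unif_deg n (b + d + a * c) - w * unif_deg (Suc n) (b + d + a * c)"
    and p: "p > 0"
  shows "real CARD('k) ^ n * cmod (z - w) \<le> schatten_norm p F T"
proof -
  let ?A = "polys_lt n :: 'k poly set" and ?B = "polys_lt (2 * n) :: 'k poly set"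
  let ?q = "real CARD('k)" let ?Y = "\<eta> ` (?A \<times> ?B)"
  define s where "s u = z * unif_deg n u - w * unif_deg (Suc n) u" for u :: "'k poly"
  define v where "v y = (of_bool (y \<in> ?Y) :: complex)" for y
  have s: "(\<Sum>u\<in>?B. s u) = z - w"
    unfolding s_def sum_subtractf sum_distrib_left[symmetric] of_real_sum[symmetric]
    using Suc_less_2n by (simp add: sum_unif_deg)
  have v_eta: "v (\<eta> (c, d)) = 1" if "c \<in> ?A" "d \<in> ?B" for c d
    using that unfolding v_def by auto
  have row: "(\<Sum>y\<in>F. T (\<xi> (a, b)) y * v y) = ?q ^ n * (z - w)" if "a \<in> ?A" "b \<in> ?B" for a b
  proof -
    have "(\<Sum>y\<in>F. T (\<xi> (a, b)) y * v y) = (\<Sum>c\<in>?A. \<Sum>d\<in>?B. s (d + b + a * c))"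
      by (subst sum_right) (use that in \<open>auto simp: zero_right T v_eta s_def add.commute intro!: sum.cong\<close>)
    also have "\<dots> = (\<Sum>c\<in>?A. z - w)"
      using that s by (intro sum.cong refl) (simp add: sum_polys_lt_center)
    finally show ?thesis by (simp add: card_polys_lt)
  qed
  have "(\<Sum>y'\<in>F. (\<Sum>x\<in>F. cnj (T x y) * T x y') * v y') =
      complex_of_real ((?q ^ n * cmod (z - w))\<^sup>2) * v y" if y: "y \<in> F" for y
  proof (cases "y \<in> ?Y")
    case False
    thus ?thesis by (simp add: zero_right v_def)
  next
    case True
    then obtain c d where cd: "c \<in> ?A" "d \<in> ?B" "y = \<eta> (c, d)" by auto
    have "(\<Sum>y'\<in>F. (\<Sum>x\<in>F. cnj (T x y) * T x y') * v y') =
        (\<Sum>x\<in>F. cnj (T x y) * (\<Sum>y'\<in>F. T x y' * v y'))"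
      unfolding sum_distrib_left sum_distrib_right by (subst sum.swap) (simp add: mult.assoc)
    also have "\<dots> = (\<Sum>a\<in>?A. \<Sum>b\<in>?B. cnj (s (b + d + a * c)) * (?q ^ n * (z - w)))"
      by (subst sum_left) (use cd in \<open>auto simp: zero_left T row s_def intro!: sum.cong\<close>)
    also have "\<dots> = (\<Sum>a\<in>?A. cnj (z - w) * (?q ^ n * (z - w)))"
      using cd s sum_polys_lt_center[of _ c d "\<lambda>u. cnj (s u)"]
      by (intro sum.cong refl) (simp add: sum_distrib_right[symmetric] cnj_sum[symmetric] del: cnj_sum)
    also have "\<dots> = ?q ^ n * ?q ^ n * ((z - w) * cnj (z - w))"
      by (simp add: card_polys_lt)
    also have "\<dots> = complex_of_real ((?q ^ n * cmod (z - w))\<^sup>2)"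
      unfolding power_mult_distrib of_real_mult complex_norm_square by (simp add: power2_eq_square)
    finally show ?thesis using cd v_eta by simp
  qed
  moreover have "\<eta> (0, 0) \<in> F" "v (\<eta> (0, 0)) \<noteq> 0" using sub v_eta by auto
  ultimately have "sqrt (cmod (complex_of_real ((?q ^ n * cmod (z - w))\<^sup>2))) \<le> schatten_norm p F T"
    using schatten_norm_ge[where T = T and v = v and ?y0.0 = "\<eta> (0, 0)", OF F p] by blast
  thus ?thesis by (simp add: norm_power norm_mult real_sqrt_abs abs_mult)
qed

text \<open>Feeds \<open>schatten_norm_le\<close> with a row sum bound for the Gram matrix, small
  because most of its entries vanish, and with the Hilbert-Schmidt norm.\<close>

lemma schatten_norm_le_deg_diff:
  assumes T: "\<And>a b c d. a \<in> polys_lt n \<Longrightarrow> b \<in> polys_lt (2 * n) \<Longrightarrow> c \<in> polys_lt n \<Longrightarrow>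
      d \<in> polys_lt (2 * n) \<Longrightarrow> T (\<xi> (a, b)) (\<eta> (c, d)) = deg_diff n (b + d + a * c)"
    and p: "p \<ge> 2"
  shows "schatten_norm p F T \<le>
    ((4 * real CARD('k) ^ (n + 2)) powr (p/2 - 1) * (2 * real CARD('k) ^ (3 * n))) powr (1/p)"
proof -
  let ?A = "polys_lt n :: 'k poly set" and ?B = "polys_lt (2 * n) :: 'k poly set"
  let ?q = "real CARD('k)" let ?Y = "\<eta> ` (?A \<times> ?B)"
  let ?t = "deg_diff n :: 'k poly \<Rightarrow> real"
  \<comment> \<open>Substituting \<open>u = b + d + a * c\<close> leaves only the differences
    \<open>c' - c\<close> and \<open>d' - d\<close>, and isolates a sum over \<open>a\<close> of the
    form treated by \<open>sum_deg_diff_affine\<close>.\<close>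
  have gram: "(\<Sum>x\<in>F. cnj (T x (\<eta> (c, d))) * T x (\<eta> (c', d'))) =
      complex_of_real (\<Sum>u\<in>?B. ?t u * (\<Sum>a\<in>?A. ?t (u + (d' - d) + a * (c' - c))))"
    if cd: "c \<in> ?A" "d \<in> ?B" "c' \<in> ?A" "d' \<in> ?B" for c d c' d'
  proof -
    have "(\<Sum>x\<in>F. cnj (T x (\<eta> (c, d))) * T x (\<eta> (c', d'))) =
      (\<Sum>a\<in>?A. \<Sum>b\<in>?B. complex_of_real (?t (b + d + a * c) * ?t (b + d' + a * c')))"
      by (subst sum_left) (use cd in \<open>auto simp: zero_left T intro!: sum.cong\<close>)
    also have "\<dots> = complex_of_real (\<Sum>a\<in>?A. \<Sum>b\<in>?B. ?t (b + d + a * c) * ?t (b + d' + a * c'))"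
      by simp
    also have "(\<Sum>a\<in>?A. \<Sum>b\<in>?B. ?t (b + d + a * c) * ?t (b + d' + a * c')) =
       (\<Sum>a\<in>?A. \<Sum>u\<in>?B. ?t u * ?t (u + (d' - d) + a * (c' - c)))"
    proof (rule sum.cong[OF refl])
      fix a assume "a \<in> ?A"
      thus "(\<Sum>b\<in>?B. ?t (b + d + a * c) * ?t (b + d' + a * c')) =
         (\<Sum>u\<in>?B. ?t u * ?t (u + (d' - d) + a * (c' - c)))"
        using cd sum_polys_lt_center[of a c d "\<lambda>u. ?t u * ?t (u + (d' - d) + a * (c' - c))"]
        by (simp add: algebra_simps)
    qed
    also have "\<dots> = (\<Sum>u\<in>?B. ?t u * (\<Sum>a\<in>?A. ?t (u + (d' - d) + a * (c' - c))))"
      by (subst sum.swap) (simp add: sum_distrib_left)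
    finally show ?thesis .
  qed
  define H where "H \<gamma> \<delta> = \<bar>\<Sum>u\<in>?B. ?t u * (\<Sum>a\<in>?A. ?t (u + \<delta> + a * \<gamma>))\<bar>" for \<gamma> \<delta>
  \<comment> \<open>No cancellation is used here: there are \<open>q ^ n\<close> choices of
    \<open>a\<close>, each costing the square of the l1 norm of \<open>?t\<close>.\<close>
  have H_small: "(\<Sum>\<delta>\<in>?B. H \<gamma> \<delta>) \<le> 4 * ?q ^ n" if \<gamma>: "\<gamma> \<in> ?A" for \<gamma>
  proof -
    have "(\<Sum>\<delta>\<in>?B. H \<gamma> \<delta>) \<le> (\<Sum>\<delta>\<in>?B. \<Sum>u\<in>?B. \<bar>?t u\<bar> * (\<Sum>a\<in>?A. \<bar>?t (u + \<delta> + a * \<gamma>)\<bar>))"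
      unfolding H_def
      by (intro sum_mono order_trans[OF sum_abs]) (auto simp: abs_mult intro!: mult_left_mono sum_mono)
    also have "\<dots> = (\<Sum>u\<in>?B. \<bar>?t u\<bar> * (\<Sum>a\<in>?A. \<Sum>\<delta>\<in>?B. \<bar>?t (\<delta> + u + a * \<gamma>)\<bar>))"
      by (subst sum.swap, subst (2) sum.swap) (simp add: sum_distrib_left add.commute)
    also have "\<dots> = (\<Sum>u\<in>?B. \<bar>?t u\<bar> * (\<Sum>a\<in>?A. \<Sum>v\<in>?B. \<bar>?t v\<bar>))"
      using \<gamma> sum_polys_lt_center[of _ \<gamma> _ "\<lambda>v. \<bar>?t v\<bar>"]
      by simp
    also have "\<dots> = ?q ^ n * ((\<Sum>u\<in>?B. \<bar>?t u\<bar>) * (\<Sum>u\<in>?B. \<bar>?t u\<bar>))"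
      by (simp add: sum_distrib_right[symmetric] card_polys_lt)
    also have "\<dots> \<le> ?q ^ n * (2 * 2)"
      by (intro mult_left_mono mult_mono sum_abs_deg_diff[OF Suc_less_2n] sum_nonneg) auto
    finally show ?thesis by simp
  qed
  have H_zero: "H \<gamma> \<delta> = 0" if "\<gamma> \<in> ?A" "\<gamma> \<notin> polys_lt 2" for \<gamma> \<delta>
    unfolding H_def using sum_deg_diff_affine[OF that] by simp
  have rows: "(\<Sum>y'\<in>F. cmod (\<Sum>x\<in>F. cnj (T x y) * T x y')) \<le> 4 * ?q ^ (n + 2)"
    if y: "y \<in> F" for y
  proof (cases "y \<in> ?Y")
    case False
    thus ?thesis by (simp add: zero_right)
  next
    case True
    then obtain c d where cd: "c \<in> ?A" "d \<in> ?B" "y = \<eta> (c, d)" by auto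
    have "(\<Sum>y'\<in>F. cmod (\<Sum>x\<in>F. cnj (T x y) * T x y')) =
        (\<Sum>c'\<in>?A. \<Sum>d'\<in>?B. H (c' - c) (d' - d))"
      by (subst sum_right) (use cd in \<open>auto simp: zero_right gram H_def simp del: of_real_sum of_real_mult intro!: sum.cong\<close>)
    also have "\<dots> = (\<Sum>\<gamma>\<in>?A. \<Sum>\<delta>\<in>?B. H \<gamma> \<delta>)"
      using sum_polys_lt_shift[of "- d" "2 * n" "\<lambda>\<delta>. H _ \<delta>"]
        sum_polys_lt_shift[of "- c" n "\<lambda>\<gamma>. \<Sum>\<delta>\<in>?B. H \<gamma> \<delta>"] cd
      by (simp add: polys_lt_uminus)
    \<comment> \<open>Only the \<open>q ^ 2\<close> differences of degree at most 1 survive, whence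
      the exponent \<open>n + 2\<close>.\<close>
    also have "\<dots> = (\<Sum>\<gamma>\<in>polys_lt 2. \<Sum>\<delta>\<in>?B. H \<gamma> \<delta>)"
      by (rule sum.mono_neutral_right) (use polys_lt_mono[OF n] H_zero in auto)
    also have "\<dots> \<le> (\<Sum>\<gamma>\<in>(polys_lt 2 :: 'k poly set). 4 * ?q ^ n)"
      by (rule sum_mono) (use polys_lt_mono[OF n] H_small in auto)
    also have "\<dots> = 4 * ?q ^ (n + 2)"
      by (simp add: card_polys_lt power_add power2_eq_square)
    finally show ?thesis .
  qed
  have "(\<Sum>y\<in>F. \<Sum>x\<in>F. (cmod (T x y))\<^sup>2) =
      (\<Sum>c\<in>?A. \<Sum>d\<in>?B. \<Sum>a\<in>?A. \<Sum>b\<in>?B. (?t (b + d + a * c))\<^sup>2)"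
    by (subst sum_right, simp add: zero_right, subst sum_left, simp add: zero_left)
       (auto simp: T intro!: sum.cong)
  also have "\<dots> = (\<Sum>c\<in>?A. \<Sum>d\<in>?B. \<Sum>a\<in>?A. \<Sum>u\<in>?B. (?t u)\<^sup>2)"
    using sum_polys_lt_center[of _ _ _ "\<lambda>u. (?t u)\<^sup>2"] by simp
  \<comment> \<open>The exponent \<open>n + 2 * n + n\<close> counts \<open>c\<close>,
    \<open>d\<close> and \<open>a\<close>.\<close>
  also have "\<dots> = ?q ^ (4 * n) * (\<Sum>u\<in>?B. (?t u)\<^sup>2)"
    by (simp add: card_polys_lt power_add[symmetric] mult.assoc[symmetric])
  also have "\<dots> \<le> ?q ^ (4 * n) * (2 / ?q ^ n)"
    by (rule mult_left_mono[OF sum_deg_diff_square[OF Suc_less_2n]]) simp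
  also have "\<dots> = 2 * ?q ^ (3 * n)"
  proof -
    have "?q ^ (4 * n) = ?q ^ (3 * n) * ?q ^ n" by (simp add: power_add[symmetric])
    thus ?thesis by simp
  qed
  finally have HS: "(\<Sum>y\<in>F. \<Sum>x\<in>F. (cmod (T x y))\<^sup>2) \<le> 2 * ?q ^ (3 * n)" .
  have "schatten_norm p F T \<le> ((4 * ?q ^ (n + 2)) powr (p/2 - 1) * (\<Sum>y\<in>F. \<Sum>x\<in>F. (cmod (T x y))\<^sup>2)) powr (1/p)"
    by (rule schatten_norm_le[OF F p rows])
  also have "\<dots> \<le> ((4 * ?q ^ (n + 2)) powr (p/2 - 1) * (2 * ?q ^ (3 * n))) powr (1/p)"
    using p HS by (intro powr_mono2 mult_left_mono) (auto intro!: mult_nonneg_nonneg sum_nonneg)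
  finally show ?thesis .
qed

end

section \<open>Symplectic 4 x 4 matrices\<close>

text \<open>All sixteen entries are explicit, so that matrix identities reduce to polynomial
  identities by simplification.\<close>

definition m4 :: "'a \<Rightarrow> 'a \<Rightarrow> 'a \<Rightarrow> 'a \<Rightarrow> 'a \<Rightarrow> 'a \<Rightarrow> 'a \<Rightarrow> 'a \<Rightarrow>
    'a \<Rightarrow> 'a \<Rightarrow> 'a \<Rightarrow> 'a \<Rightarrow> 'a \<Rightarrow> 'a \<Rightarrow> 'a \<Rightarrow> 'a \<Rightarrow> 'a mat" where
  "m4 a b c d e f g h i j k l m n r s =
     mat 4 4 (\<lambda>(x, y). [[a, b, c, d], [e, f, g, h], [i, j, k, l], [m, n, r, s]] ! x ! y)"

lemma less_4_cases: "(x::nat) < 4 \<Longrightarrow> x = 0 \<or> x = 1 \<or> x = 2 \<or> x = 3"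
  by auto

lemma m4_dim [simp]:
  "m4 a b c d e f g h i j k l m n r s \<in> carrier_mat 4 4"
  "dim_row (m4 a b c d e f g h i j k l m n r s) = 4"
  "dim_col (m4 a b c d e f g h i j k l m n r s) = 4"
  by (auto simp: m4_def)

lemma m4_index [simp]:
  "m4 a b c d e f g h i j k l m n r s $$ (0, 0) = a"
  "m4 a b c d e f g h i j k l m n r s $$ (0, Suc 0) = b"
  "m4 a b c d e f g h i j k l m n r s $$ (0, 2) = c"
  "m4 a b c d e f g h i j k l m n r s $$ (0, 3) = d"
  "m4 a b c d e f g h i j k l m n r s $$ (Suc 0, 0) = e"
  "m4 a b c d e f g h i j k l m n r s $$ (Suc 0, Suc 0) = f"
  "m4 a b c d e f g h i j k l m n r s $$ (Suc 0, 2) = g"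
  "m4 a b c d e f g h i j k l m n r s $$ (Suc 0, 3) = h"
  "m4 a b c d e f g h i j k l m n r s $$ (2, 0) = i"
  "m4 a b c d e f g h i j k l m n r s $$ (2, Suc 0) = j"
  "m4 a b c d e f g h i j k l m n r s $$ (2, 2) = k"
  "m4 a b c d e f g h i j k l m n r s $$ (2, 3) = l"
  "m4 a b c d e f g h i j k l m n r s $$ (3, 0) = m"
  "m4 a b c d e f g h i j k l m n r s $$ (3, Suc 0) = n"
  "m4 a b c d e f g h i j k l m n r s $$ (3, 2) = r"
  "m4 a b c d e f g h i j k l m n r s $$ (3, 3) = s"
  by (simp_all add: m4_def nth_Cons')

lemma mat4_eqI:
  assumes "A \<in> carrier_mat 4 4" "B \<in> carrier_mat 4 4"
    "A $$ (0, 0) = B $$ (0, 0)" "A $$ (0, Suc 0) = B $$ (0, Suc 0)"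
    "A $$ (0, 2) = B $$ (0, 2)" "A $$ (0, 3) = B $$ (0, 3)"
    "A $$ (Suc 0, 0) = B $$ (Suc 0, 0)" "A $$ (Suc 0, Suc 0) = B $$ (Suc 0, Suc 0)"
    "A $$ (Suc 0, 2) = B $$ (Suc 0, 2)" "A $$ (Suc 0, 3) = B $$ (Suc 0, 3)"
    "A $$ (2, 0) = B $$ (2, 0)" "A $$ (2, Suc 0) = B $$ (2, Suc 0)"
    "A $$ (2, 2) = B $$ (2, 2)" "A $$ (2, 3) = B $$ (2, 3)"
    "A $$ (3, 0) = B $$ (3, 0)" "A $$ (3, Suc 0) = B $$ (3, Suc 0)"
    "A $$ (3, 2) = B $$ (3, 2)" "A $$ (3, 3) = B $$ (3, 3)"
  shows "A = B"
proof (rule eq_matI)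
  fix i j assume "i < dim_row B" "j < dim_col B"
  thus "A $$ (i, j) = B $$ (i, j)"
    using assms(2-) less_4_cases[of i] less_4_cases[of j] by auto
qed (use assms in auto)

lemma m4_eta:
  assumes "A \<in> carrier_mat 4 4"
  shows "m4 (A $$ (0, 0)) (A $$ (0, Suc 0)) (A $$ (0, 2)) (A $$ (0, 3))
    (A $$ (Suc 0, 0)) (A $$ (Suc 0, Suc 0)) (A $$ (Suc 0, 2)) (A $$ (Suc 0, 3))
    (A $$ (2, 0)) (A $$ (2, Suc 0)) (A $$ (2, 2)) (A $$ (2, 3))
    (A $$ (3, 0)) (A $$ (3, Suc 0)) (A $$ (3, 2)) (A $$ (3, 3)) = A"
  by (rule mat4_eqI) (use assms in auto)

lemma m4_cases:
  assumes "A \<in> carrier_mat 4 4"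
  obtains a b c d e f g h i j k l m n r s where "A = m4 a b c d e f g h i j k l m n r s"
  using m4_eta[OF assms] by metis

lemma m4_eq_iff:
  "m4 a b c d e f g h i j k l m n r s = m4 a' b' c' d' e' f' g' h' i' j' k' l' m' n' r' s' \<longleftrightarrow>
    a = a' \<and> b = b' \<and> c = c' \<and> d = d' \<and> e = e' \<and> f = f' \<and> g = g' \<and> h = h' \<and>
    i = i' \<and> j = j' \<and> k = k' \<and> l = l' \<and> m = m' \<and> n = n' \<and> r = r' \<and> s = s'"
  by (metis m4_index)

lemma mat4_mult_index:
  fixes A B :: "'a::semiring_0 mat"
  assumes "A \<in> carrier_mat 4 4" "B \<in> carrier_mat 4 4" "i < 4" "j < 4"
  shows "(A * B) $$ (i, j) = A $$ (i, 0) * B $$ (0, j) + A $$ (i, Suc 0) * B $$ (Suc 0, j) +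
    A $$ (i, 2) * B $$ (2, j) + A $$ (i, 3) * B $$ (3, j)"
  using assms by (simp add: scalar_prod_def eval_nat_numeral atLeast0_lessThan_Suc ac_simps)

lemma mult_carrier_4 [simp]:
  "A \<in> carrier_mat 4 4 \<Longrightarrow> B \<in> carrier_mat 4 4 \<Longrightarrow> A * B \<in> carrier_mat 4 4"
  by (rule mult_carrier_mat)

lemma assoc_mult_4:
  fixes A B C :: "'a::semiring_0 mat"
  shows "A \<in> carrier_mat 4 4 \<Longrightarrow> B \<in> carrier_mat 4 4 \<Longrightarrow> C \<in> carrier_mat 4 4 \<Longrightarrow> A * B * C = A * (B * C)"
  by (rule assoc_mult_mat)

lemma m4_mult [simp]:
  fixes a :: "'a::semiring_0"
  shows "m4 a b c d e f g h i j k l m n r s * m4 a' b' c' d' e' f' g' h' i' j' k' l' m' n' r' s' =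
   m4 (a * a' + b * e' + c * i' + d * m') (a * b' + b * f' + c * j' + d * n') (a * c' + b * g' + c * k' + d * r') (a * d' + b * h' + c * l' + d * s')
      (e * a' + f * e' + g * i' + h * m') (e * b' + f * f' + g * j' + h * n') (e * c' + f * g' + g * k' + h * r') (e * d' + f * h' + g * l' + h * s')
      (i * a' + j * e' + k * i' + l * m') (i * b' + j * f' + k * j' + l * n') (i * c' + j * g' + k * k' + l * r') (i * d' + j * h' + k * l' + l * s')
      (m * a' + n * e' + r * i' + s * m') (m * b' + n * f' + r * j' + s * n') (m * c' + n * g' + r * k' + s * r') (m * d' + n * h' + r * l' + s * s')"
  by (rule mat4_eqI) (simp_all add: mat4_mult_index del: index_mult_mat)

lemma m4_transpose [simp]:
  "transpose_mat (m4 a b c d e f g h i j k l m n r s) = m4 a e i m b f j n c g k r d h l s"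
  by (rule mat4_eqI) simp_all

lemma m4_one: "1\<^sub>m 4 = m4 1 0 0 0 0 1 0 0 0 0 1 0 0 0 0 1"
  by (rule mat4_eqI) simp_all

lemma m4_J: "J_sp = m4 0 0 0 1 0 0 1 0 0 (-1) 0 0 (-1) 0 0 0"
  by (rule mat4_eqI) (simp_all add: J_sp_def)

text \<open>The form is alternating, so one equation per pair of distinct columns suffices, six in
  all.\<close>

lemma Sp4_m4:
  fixes a :: "'k::comm_ring_1 poly"
  shows "m4 a b c d e f g h i j k l m n r s \<in> Sp4 \<longleftrightarrow>
    a * n + e * j - i * f - m * b = 0 \<and> a * r + e * k - i * g - m * c = 0 \<and>
    a * s + e * l - i * h - m * d = 1 \<and> b * r + f * k - j * g - n * c = 1 \<and>
    b * s + f * l - j * h - n * d = 0 \<and> c * s + g * l - k * h - r * d = 0"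
  unfolding Sp4_def m4_J by (auto simp: m4_eq_iff algebra_simps)

lemma Sp4_carrier: "A \<in> Sp4 \<Longrightarrow> A \<in> carrier_mat 4 4"
  unfolding Sp4_def by simp

lemma J_carrier [simp]: "J_sp \<in> carrier_mat 4 4"
  unfolding m4_J by simp

lemma one_Sp4: "1\<^sub>m 4 \<in> Sp4"
  unfolding m4_one Sp4_m4 by simp

lemma mult_Sp4:
  assumes "A \<in> Sp4" "B \<in> (Sp4 :: 'k::comm_ring_1 poly mat set)"
  shows "A * B \<in> Sp4"
proof -
  note c = Sp4_carrier[OF assms(1)] Sp4_carrier[OF assms(2)]
  have "transpose_mat (A * B) * J_sp * (A * B) = transpose_mat B * (transpose_mat A * J_sp * A) * B"
    using c by (simp add: transpose_mult[OF c] assoc_mult_4)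
  also have "\<dots> = J_sp" using assms unfolding Sp4_def by simp
  finally show ?thesis using c unfolding Sp4_def by simp
qed

text \<open>Entries lie in a commutative ring, so the adjugate takes the place of linear algebra
  over a field: \<open>det B\<close> inverts \<open>det A\<close>.\<close>

lemma left_inverse_imp_right_inverse:
  fixes A B :: "'a::comm_ring_1 mat"
  assumes A: "A \<in> carrier_mat n n" and B: "B \<in> carrier_mat n n" and BA: "B * A = 1\<^sub>m n"
  shows "A * B = 1\<^sub>m n"
proof -
  let ?C = "det B \<cdot>\<^sub>m adj_mat A"
  have C: "?C \<in> carrier_mat n n" using adj_mat[OF A] by simp
  have "det B * det A = 1" using det_mult[OF B A] BA by simp
  hence AC: "A * ?C = 1\<^sub>m n" using adj_mat[OF A] A B
    by (simp add: mult_smult_distrib[OF A]) (rule eq_matI, auto simp flip: mult.assoc)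
  have "B = B * (A * ?C)" using AC B by simp
  also have "\<dots> = (B * A) * ?C" using assoc_mult_mat[OF B A C] by simp
  finally have "B = ?C" using BA left_mult_one_mat[OF C] by simp
  thus ?thesis using AC by simp
qed

lemma sp_inv_eqI:
  assumes A: "A \<in> carrier_mat 4 4" and B: "B \<in> carrier_mat 4 4" and BA: "B * A = 1\<^sub>m 4"
  shows "sp_inv A = B"
  unfolding sp_inv_def
proof (rule the_equality)
  show "B \<in> carrier_mat 4 4 \<and> A * B = 1\<^sub>m 4 \<and> B * A = 1\<^sub>m 4"
    using left_inverse_imp_right_inverse[OF A B BA] B BA by simp
  fix C assume C: "C \<in> carrier_mat 4 4 \<and> A * C = 1\<^sub>m 4 \<and> C * A = 1\<^sub>m 4"
  have "C = (B * A) * C" using BA C left_mult_one_mat[of C 4 4] by simp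
  also have "\<dots> = B * (A * C)" using A B C by (simp add: assoc_mult_4)
  finally show "C = B" using C B right_mult_one_mat[of B 4 4] by simp
qed

text \<open>Multiply the defining equation on the left by the transpose of \<open>J_sp\<close>,
  which is the inverse of \<open>J_sp\<close>.\<close>

lemma sp_inv:
  assumes "A \<in> (Sp4 :: 'k::comm_ring_1 poly mat set)"
  shows "sp_inv A = transpose_mat J_sp * transpose_mat A * J_sp" "sp_inv A \<in> Sp4"
    "sp_inv A * A = 1\<^sub>m 4" "A * sp_inv A = 1\<^sub>m 4"
proof -
  note A = Sp4_carrier[OF assms]
  let ?B = "transpose_mat J_sp * transpose_mat A * J_sp"
  have B: "?B \<in> carrier_mat 4 4" using A by simp
  have "?B * A = transpose_mat J_sp * (transpose_mat A * J_sp * A)"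
    using A by (simp add: assoc_mult_4)
  also have "\<dots> = 1\<^sub>m 4" using assms unfolding Sp4_def by (simp add: m4_J m4_one)
  finally have BA: "?B * A = 1\<^sub>m 4" .
  show inv: "sp_inv A = ?B" by (rule sp_inv_eqI[OF A B BA])
  show "sp_inv A * A = 1\<^sub>m 4" unfolding inv by (rule BA)
  have AB: "A * ?B = 1\<^sub>m 4" by (rule left_inverse_imp_right_inverse[OF A B BA])
  thus "A * sp_inv A = 1\<^sub>m 4" unfolding inv .
  have "transpose_mat ?B * J_sp * ?B = transpose_mat ?B * (transpose_mat A * J_sp * A) * ?B"
    using assms unfolding Sp4_def by simp
  also have "\<dots> = (transpose_mat ?B * transpose_mat A) * J_sp * (A * ?B)"
    using A B by (simp add: assoc_mult_4)
  also have "transpose_mat ?B * transpose_mat A = 1\<^sub>m 4"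
    using transpose_mult[OF A B] AB by simp
  also have "1\<^sub>m 4 * J_sp * (A * ?B) = J_sp" unfolding AB by (simp add: right_mult_one_mat[of _ 4 4] left_mult_one_mat[of _ 4 4])
  finally show "sp_inv A \<in> Sp4" unfolding inv Sp4_def using B by simp
qed

lemma sp_inv_mult:
  assumes "A \<in> Sp4" "B \<in> (Sp4 :: 'k::comm_ring_1 poly mat set)"
  shows "sp_inv (A * B) = sp_inv B * sp_inv A"
proof (rule sp_inv_eqI)
  note c = Sp4_carrier[OF assms(1)] Sp4_carrier[OF assms(2)]
    Sp4_carrier[OF sp_inv(2)[OF assms(1)]] Sp4_carrier[OF sp_inv(2)[OF assms(2)]]
  show "A * B \<in> carrier_mat 4 4" "sp_inv B * sp_inv A \<in> carrier_mat 4 4" using c by auto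
  have "sp_inv B * sp_inv A * (A * B) = sp_inv B * ((sp_inv A * A) * B)"
    using c by (simp add: assoc_mult_4)
  thus "sp_inv B * sp_inv A * (A * B) = 1\<^sub>m 4"
    using c sp_inv[OF assms(1)] sp_inv[OF assms(2)] by simp
qed

lemma sp_inv_mult_cancel:
  assumes "A \<in> Sp4" "B \<in> (Sp4 :: 'k::comm_ring_1 poly mat set)"
  shows "sp_inv A * (A * B) = B"
  using assms sp_inv[OF assms(1)] Sp4_carrier[of A] Sp4_carrier[of B] Sp4_carrier[of "sp_inv A"]
    assoc_mult_mat[of "sp_inv A" 4 4 A 4 B 4] by simp

section \<open>Entry degrees of polynomial matrices\<close>

definition mdeg :: "'k::zero poly mat \<Rightarrow> nat" where
  "mdeg A = Max ((\<lambda>ij. degree (A $$ ij)) ` ({..<4} \<times> {..<4}))"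

lemma mdeg_le_iff: "mdeg A \<le> d \<longleftrightarrow> (\<forall>i<4. \<forall>j<4. degree (A $$ (i, j)) \<le> d)"
  unfolding mdeg_def by (subst Max_le_iff) (auto simp: lessThan_empty_iff)

lemma degree_le_mdeg: "i < 4 \<Longrightarrow> j < 4 \<Longrightarrow> degree (A $$ (i, j)) \<le> mdeg A"
  using mdeg_le_iff[of A "mdeg A"] by simp

lemma mdeg_m4_le_iff:
  "mdeg (m4 a b c d e f g h i j k l m n r s) \<le> D \<longleftrightarrow>
    degree a \<le> D \<and> degree b \<le> D \<and> degree c \<le> D \<and> degree d \<le> D \<and>
    degree e \<le> D \<and> degree f \<le> D \<and> degree g \<le> D \<and> degree h \<le> D \<and>
    degree i \<le> D \<and> degree j \<le> D \<and> degree k \<le> D \<and> degree l \<le> D \<and>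
    degree m \<le> D \<and> degree n \<le> D \<and> degree r \<le> D \<and> degree s \<le> D"
proof -
  have all4: "(\<forall>x<4. Q x) \<longleftrightarrow> Q 0 \<and> Q (Suc 0) \<and> Q 2 \<and> Q 3" for Q :: "nat \<Rightarrow> bool"
    using less_4_cases by auto
  show ?thesis unfolding mdeg_le_iff all4 m4_index by blast
qed

lemma mdeg_mult:
  fixes A B :: "'k::comm_ring_1 poly mat"
  assumes "A \<in> carrier_mat 4 4" "B \<in> carrier_mat 4 4"
  shows "mdeg (A * B) \<le> mdeg A + mdeg B"
  unfolding mdeg_le_iff
proof (intro allI impI)
  fix i j :: nat assume ij: "i < 4" "j < 4"
  have "(A * B) $$ (i, j) = (\<Sum>k<4. A $$ (i, k) * B $$ (k, j))"
    using assms ij by (auto simp: scalar_prod_def atLeast0LessThan intro!: sum.cong)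
  also have "degree \<dots> \<le> mdeg A + mdeg B"
    by (rule degree_sum_le) (use ij in \<open>auto intro!: order_trans[OF degree_mult_le] add_mono degree_le_mdeg\<close>)
  finally show "degree ((A * B) $$ (i, j)) \<le> mdeg A + mdeg B" .
qed

lemma mdeg_one [simp]: "mdeg (1\<^sub>m 4 :: 'k::comm_ring_1 poly mat) = 0"
  using mdeg_m4_le_iff[of 1 0 0 0 0 1 0 0 0 0 1 0 0 0 0 1 0] unfolding m4_one by simp

text \<open>Inversion only transposes, permutes and changes signs of entries, as \<open>J_sp\<close>
  is constant.\<close>

lemma mdeg_sp_inv:
  assumes "A \<in> (Sp4 :: 'k::comm_ring_1 poly mat set)"
  shows "mdeg (sp_inv A) \<le> mdeg A"
proof -
  have J: "mdeg (J_sp :: 'k poly mat) = 0"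
    using mdeg_m4_le_iff[of 0 0 0 1 0 0 1 0 0 "-1::'k poly" 0 0 "-1" 0 0 0 0] unfolding m4_J by simp
  have tr: "mdeg (transpose_mat B) \<le> mdeg B" if "B \<in> carrier_mat 4 4" for B :: "'k poly mat"
    unfolding mdeg_le_iff using that by (auto intro: degree_le_mdeg)
  note c = Sp4_carrier[OF assms]
  show ?thesis
    unfolding sp_inv(1)[OF assms]
    using mdeg_mult[of "transpose_mat J_sp * transpose_mat A" J_sp]
      mdeg_mult[of "transpose_mat J_sp" "transpose_mat A"] tr[OF c] tr[OF J_carrier] c J
    by simp
qed

section \<open>Words and subgroups\<close>

text \<open>A generating set chosen for convenience: closed under inverses, finite over a finite
  field, and containing all the constant and linear matrices used below.\<close>

definition gens :: "'k::comm_ring_1 poly mat set" where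
  "gens = {A \<in> Sp4. mdeg A \<le> 1}"

definition word_ball :: "nat \<Rightarrow> 'k::comm_ring_1 poly mat set" where
  "word_ball n = {word_prod xs |xs. length xs \<le> n \<and> set xs \<subseteq> gens}"

lemma word_prod_simps [simp]:
  "word_prod [] = 1\<^sub>m 4" "word_prod (x # xs) = x * word_prod xs"
  unfolding word_prod_def by simp_all

lemma word_prod_Sp4: "set xs \<subseteq> Sp4 \<Longrightarrow> word_prod xs \<in> Sp4"
  by (induction xs) (auto simp: one_Sp4 mult_Sp4)

lemma word_prod_append:
  "set xs \<subseteq> Sp4 \<Longrightarrow> set ys \<subseteq> Sp4 \<Longrightarrow> word_prod (xs @ ys) = word_prod xs * word_prod ys"
proof (induction xs)
  case Nil
  thus ?case using left_mult_one_mat[OF Sp4_carrier[OF word_prod_Sp4[of ys]]] by simp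
next
  case (Cons x xs)
  thus ?case using Sp4_carrier[OF word_prod_Sp4, of xs] Sp4_carrier[OF word_prod_Sp4, of ys] Sp4_carrier[of x]
    by (auto simp: assoc_mult_4)
qed

lemma gens_Sp4: "gens \<subseteq> Sp4"
  unfolding gens_def by auto

lemma word_ball_Sp4: "g \<in> word_ball n \<Longrightarrow> g \<in> Sp4"
  unfolding word_ball_def using word_prod_Sp4 gens_Sp4 by blast

lemma word_ball_mono: "m \<le> n \<Longrightarrow> word_ball m \<subseteq> word_ball n"
  unfolding word_ball_def by (auto intro: order_trans)

lemma word_ball_monoD: "g \<in> word_ball m \<Longrightarrow> m \<le> n \<Longrightarrow> g \<in> word_ball n"
  using word_ball_mono by blast

lemma word_ball_one: "1\<^sub>m 4 \<in> word_ball n"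
  unfolding word_ball_def by (auto intro!: exI[of _ "[]"])

lemma word_ball_mult:
  assumes "g \<in> word_ball m" "h \<in> word_ball n"
  shows "g * h \<in> word_ball (m + n)"
proof -
  obtain xs ys where "length xs \<le> m" "set xs \<subseteq> gens" "g = word_prod xs"
    "length ys \<le> n" "set ys \<subseteq> gens" "h = word_prod ys"
    using assms unfolding word_ball_def by blast
  thus ?thesis unfolding word_ball_def using gens_Sp4
    by (auto intro!: exI[of _ "xs @ ys"] simp: word_prod_append subset_trans[OF _ gens_Sp4])
qed

lemma gens_word_ball: "g \<in> gens \<Longrightarrow> g \<in> word_ball 1"
  unfolding word_ball_def using right_mult_one_mat[of g 4 4]
  by (auto simp: gens_def Sp4_def intro!: exI[of _ "[g]"])

lemma gens_sp_inv: "g \<in> gens \<Longrightarrow> sp_inv g \<in> gens"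
  unfolding gens_def using sp_inv(2) mdeg_sp_inv order_trans by blast

lemma word_prod_gens_cases:
  assumes "g \<in> word_ball (Suc n)"
  obtains "g \<in> word_ball n" | s h where "s \<in> gens" "h \<in> word_ball n" "g = s * h"
proof -
  obtain xs where xs: "length xs \<le> Suc n" "set xs \<subseteq> gens" "g = word_prod xs"
    using assms unfolding word_ball_def by blast
  show thesis
  proof (cases xs)
    case Nil
    thus thesis using xs that(1) by (simp add: word_ball_one)
  next
    case (Cons s ys)
    thus thesis using xs by (intro that(2)[of s "word_prod ys"]) (auto simp: word_ball_def)
  qed
qed

lemma word_ball_sp_inv: "g \<in> word_ball n \<Longrightarrow> sp_inv g \<in> word_ball n"
proof (induction n arbitrary: g)
  case 0
  hence "g = 1\<^sub>m 4" unfolding word_ball_def by auto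
  thus ?case using sp_inv_eqI[of g g] by (simp add: word_ball_one)
next
  case (Suc n)
  from Suc.prems show ?case
  proof (cases rule: word_prod_gens_cases)
    case 1
    thus ?thesis using Suc.IH word_ball_mono[of n "Suc n"] by auto
  next
    case (2 s h)
    have "sp_inv g = sp_inv h * sp_inv s"
      using 2 gens_Sp4 word_ball_Sp4 sp_inv_mult by blast
    thus ?thesis using word_ball_mult[OF Suc.IH[OF 2(2)] gens_word_ball[OF gens_sp_inv[OF 2(1)]]] by simp
  qed
qed

text \<open>The easy half of the comparison of lengths. It also bounds entries produced by a word
  without being computed, see \<open>heis_short\<close>.\<close>

lemma mdeg_word_ball: "g \<in> word_ball n \<Longrightarrow> mdeg g \<le> n"
proof (induction n arbitrary: g)
  case 0
  thus ?case unfolding word_ball_def by auto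
next
  case (Suc n)
  from Suc.prems show ?case
  proof (cases rule: word_prod_gens_cases)
    case 1
    thus ?thesis using Suc.IH by force
  next
    case (2 s h)
    have "mdeg g \<le> mdeg s + mdeg h"
      using 2 mdeg_mult Sp4_carrier gens_Sp4 word_ball_Sp4 by blast
    thus ?thesis using 2 Suc.IH[of h] unfolding gens_def by auto
  qed
qed

lemma word_ball_conj:
  assumes "g \<in> word_ball n" "w \<in> gens" "w * g * sp_inv w = h"
  shows "h \<in> word_ball (n + 2)"
  using word_ball_mult[OF word_ball_mult[OF gens_word_ball[OF assms(2)] assms(1)]
    gens_word_ball[OF gens_sp_inv[OF assms(2)]]] assms(3) by simp

section \<open>The Heisenberg subgroup and three copies of \<open>SL_2\<close>\<close>

text \<open>The unipotent radical of the stabiliser of the first coordinate line. The cocycle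
  \<open>a * c' - c * a'\<close> of its product is alternating: inversion negates all coordinates,
  and commutators acquire a factor 2.\<close>

definition heis :: "'k::comm_ring_1 poly \<Rightarrow> 'k poly \<Rightarrow> 'k poly \<Rightarrow> 'k poly mat" where
  "heis a c b = m4 1 a c b 0 1 0 c 0 0 1 (-a) 0 0 0 1"

lemma heis_Sp4: "heis a c b \<in> Sp4"
  unfolding heis_def Sp4_m4 by simp

lemma heis_mult: "heis a c b * heis a' c' b' = heis (a + a') (c + c') (b + b' + a * c' - c * a')"
  unfolding heis_def by (simp add: m4_eq_iff)

lemma heis_zero: "heis 0 0 0 = 1\<^sub>m 4"
  unfolding heis_def m4_one by simp

lemma sp_inv_heis: "sp_inv (heis a c b) = heis (-a) (-c) (-b)"
  by (rule sp_inv_eqI) (use heis_Sp4 Sp4_carrier heis_zero in \<open>auto simp: heis_mult\<close>)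

lemma heis_gens: "degree a \<le> 1 \<Longrightarrow> degree c \<le> 1 \<Longrightarrow> degree b \<le> 1 \<Longrightarrow> heis a c b \<in> gens"
  unfolding gens_def using heis_Sp4 by (auto simp: heis_def mdeg_m4_le_iff)

text \<open>Three embeddings of \<open>SL_2\<close>: \<open>mid\<close> and \<open>outer\<close>
  belong to long roots, \<open>levi\<close> to a short root. Conjugation by \<open>mid\<close> acts
  on the first two coordinates of \<open>heis\<close>; conjugation by \<open>swap\<close> exchanges
  \<open>mid\<close> with \<open>outer\<close>.\<close>

definition mid :: "'k::comm_ring_1 poly \<Rightarrow> 'k poly \<Rightarrow> 'k poly \<Rightarrow> 'k poly \<Rightarrow> 'k poly mat" where
  "mid a b c d = m4 1 0 0 0 0 a b 0 0 c d 0 0 0 0 1"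

definition outer :: "'k::comm_ring_1 poly \<Rightarrow> 'k poly \<Rightarrow> 'k poly \<Rightarrow> 'k poly \<Rightarrow> 'k poly mat" where
  "outer a b c d = m4 a 0 0 b 0 1 0 0 0 0 1 0 c 0 0 d"

definition levi :: "'k::comm_ring_1 poly \<Rightarrow> 'k poly \<Rightarrow> 'k poly \<Rightarrow> 'k poly \<Rightarrow> 'k poly mat" where
  "levi a b c d = m4 a b 0 0 c d 0 0 0 0 a (-b) 0 0 (-c) d"

definition swap :: "'k::comm_ring_1 poly mat" where
  "swap = m4 0 1 0 0 1 0 0 0 0 0 0 1 0 0 1 0"

lemma sl2_mult:
  "mid a b c d * mid a' b' c' d' = mid (a * a' + b * c') (a * b' + b * d') (c * a' + d * c') (c * b' + d * d')"
  "outer a b c d * outer a' b' c' d' = outer (a * a' + b * c') (a * b' + b * d') (c * a' + d * c') (c * b' + d * d')"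
  "levi a b c d * levi a' b' c' d' = levi (a * a' + b * c') (a * b' + b * d') (c * a' + d * c') (c * b' + d * d')"
  unfolding mid_def outer_def levi_def by (simp_all add: m4_eq_iff)

lemma sl2_one: "mid 1 0 0 1 = 1\<^sub>m 4" "outer 1 0 0 1 = 1\<^sub>m 4" "levi 1 0 0 1 = 1\<^sub>m 4"
  unfolding mid_def outer_def levi_def m4_one by simp_all

lemma sl2_Sp4:
  assumes "a * d - b * c = 1"
  shows "mid a b c d \<in> Sp4" "outer a b c d \<in> Sp4" "levi a b c d \<in> Sp4"
  using assms unfolding mid_def outer_def levi_def Sp4_m4 by (auto simp: algebra_simps)

lemma swap_gens: "swap \<in> gens"
  unfolding gens_def swap_def by (simp add: Sp4_m4 mdeg_m4_le_iff)

lemma swap_swap: "swap * swap = 1\<^sub>m 4"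
  unfolding swap_def m4_one by simp

lemma sp_inv_swap: "sp_inv swap = swap"
  by (rule sp_inv_eqI) (simp_all add: swap_swap, simp_all add: swap_def)

lemma J_gens: "J_sp \<in> gens"
  unfolding gens_def m4_J by (simp add: Sp4_m4 mdeg_m4_le_iff)

lemma sp_inv_J: "sp_inv (J_sp :: 'k::comm_ring_1 poly mat) = transpose_mat J_sp"
  by (rule sp_inv_eqI) (simp_all add: m4_J m4_one)

lemma mid_gens:
  assumes "a * d - b * c = 1" "degree a \<le> 1" "degree b \<le> 1" "degree c \<le> 1" "degree d \<le> 1"
  shows "mid a b c d \<in> gens"
  unfolding gens_def using sl2_Sp4(1)[OF assms(1)] assms by (auto simp: mid_def mdeg_m4_le_iff)

lemma sp_inv_mid:
  assumes "a * d - b * c = 1"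
  shows "sp_inv (mid a b c d) = mid d (-b) (-c) a"
proof (rule sp_inv_eqI)
  show "mid d (-b) (-c) a * mid a b c d = 1\<^sub>m 4"
    unfolding sl2_one[symmetric] sl2_mult using assms by (simp add: mult.commute)
qed (simp_all add: mid_def)

section \<open>Undistorted elementary matrices\<close>

text \<open>Right multiplication of row vectors by the matrix with rows \<open>(T, 1)\<close> and \<open>(-1, 0)\<close>.\<close>

definition step :: "'k::comm_ring_1 poly \<times> 'k poly \<Rightarrow> 'k poly \<times> 'k poly" where
  "step v = ([:0, 1:] * fst v - snd v, fst v)"

text \<open>The sums of \<open>(step ^^ i) w_i\<close> over \<open>i \<le> m\<close> with constant
  \<open>w_i\<close>, in Horner form; each level will cost a bounded number of letters.\<close>

primrec horner :: "nat \<Rightarrow> ('k::comm_ring_1 poly \<times> 'k poly) set" where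
  "horner 0 = {v. degree (fst v) = 0 \<and> degree (snd v) = 0}"
| "horner (Suc m) = {step v + w |v w. v \<in> horner m \<and> degree (fst w) = 0 \<and> degree (snd w) = 0}"

lemma step_add: "step (v + w) = step v + step w"
  unfolding step_def by (simp add: algebra_simps plus_prod_def)

lemma funpow_step_add: "(step ^^ n) (v + w) = (step ^^ n) v + (step ^^ n) w"
  by (induction n) (simp_all add: step_add)

lemma degree_add_eq_0: "degree (p::'k::comm_ring_1 poly) = 0 \<Longrightarrow> degree q = 0 \<Longrightarrow> degree (p + q) = 0"
  using degree_add_le[of p 0 q] by simp

lemma horner_add: "v \<in> horner m \<Longrightarrow> w \<in> horner m \<Longrightarrow> v + w \<in> horner m"
proof (induction m arbitrary: v w)
  case 0
  thus ?case by (simp add: degree_add_eq_0)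
next
  case (Suc m)
  obtain v1 v2 w1 w2 where v: "v = step v1 + v2" "v1 \<in> horner m" "degree (fst v2) = 0" "degree (snd v2) = 0"
    and w: "w = step w1 + w2" "w1 \<in> horner m" "degree (fst w2) = 0" "degree (snd w2) = 0"
    using Suc.prems by auto
  have "v + w = step (v1 + w1) + (v2 + w2)" unfolding v w step_add by (simp add: algebra_simps)
  moreover have "v1 + w1 \<in> horner m" using Suc.IH v w by blast
  moreover have "degree (fst (v2 + w2)) = 0" "degree (snd (v2 + w2)) = 0"
    using v w by (simp_all add: degree_add_eq_0)
  ultimately show ?case unfolding horner.simps by blast
qed

lemma horner_step: "v \<in> horner m \<Longrightarrow> step v \<in> horner (Suc m)"
  unfolding horner.simps by (rule CollectI, rule exI[of _ v], rule exI[of _ 0]) simp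

lemma horner_Suc: "v \<in> horner m \<Longrightarrow> v \<in> horner (Suc m)"
proof (induction m arbitrary: v)
  case 0
  have "v = step 0 + v" unfolding step_def by (simp add: plus_prod_def)
  thus ?case using 0 unfolding horner.simps
    by (intro CollectI exI[of _ 0] exI[of _ v]) auto
next
  case (Suc m)
  then obtain v' w where "v = step v' + w" "v' \<in> horner m" "degree (fst w) = 0" "degree (snd w) = 0"
    by auto
  thus ?case using Suc.IH[of v'] unfolding horner.simps(2)[of "Suc m"] by blast
qed

lemma horner_mono: "v \<in> horner m \<Longrightarrow> m \<le> n \<Longrightarrow> v \<in> horner n"
  by (induction n) (auto simp: le_Suc_eq intro: horner_Suc simp del: horner.simps)

lemma horner_funpow: "v \<in> horner m \<Longrightarrow> (step ^^ n) v \<in> horner (m + n)"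
  by (induction n) (auto intro: horner_step simp del: horner.simps)

text \<open>Cayley-Hamilton for a matrix of trace \<open>T\<close> and determinant 1: multiplication
  by \<open>T\<close> equals \<open>step\<close> plus its inverse.\<close>

lemma funpow_step_T:
  "(step ^^ Suc d) ([:0, 1:] * x, [:0, 1:] * y) = (step ^^ Suc (Suc d)) (x, y) + (step ^^ d) (x, y)"
proof (induction d)
  case 0
  show ?case unfolding step_def by (simp add: algebra_simps)
next
  case (Suc d)
  show ?case unfolding funpow.simps(2)[of "Suc d" step] o_def Suc.IH step_add by simp
qed

text \<open>Replacing \<open>T\<close> by \<open>step\<close> plus its inverse expands
  \<open>P\<close> in powers of \<open>step\<close> between \<open>-d\<close> and \<open>d\<close>;
  applying \<open>step\<close> another \<open>d\<close> times clears the negative ones.\<close>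

lemma funpow_step_horner:
  "degree P \<le> d \<Longrightarrow> (step ^^ d) (P, 0) \<in> horner (2 * d)"
proof (induction d arbitrary: P)
  case 0
  thus ?case by simp
next
  case (Suc d)
  obtain a P' where P: "P = pCons a P'" by (cases P)
  have deg: "degree P' \<le> d" using Suc.prems unfolding P by (auto split: if_splits)
  have split: "(P, 0) = ([:a:], 0) + ([:0, 1:] * P', [:0, 1:] * 0)"
    unfolding P by (simp add: plus_prod_def)
  have "(step ^^ Suc d) (P, 0) = (step ^^ Suc d) ([:a:], 0) + (step ^^ Suc d) ([:0, 1:] * P', [:0, 1:] * 0)"
    by (subst split) (rule funpow_step_add)
  hence "(step ^^ Suc d) (P, 0) = (step ^^ Suc d) ([:a:], 0) +
      ((step ^^ 2) ((step ^^ d) (P', 0)) + (step ^^ d) (P', 0))"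
    unfolding funpow_step_T by (simp add: numeral_2_eq_2)
  moreover have "(step ^^ Suc d) ([:a:], 0) \<in> horner (2 * Suc d)"
    using horner_mono[OF horner_funpow[of "([:a:], 0)" 0 "Suc d"], of "2 * Suc d"] by simp
  moreover have "(step ^^ 2) ((step ^^ d) (P', 0)) \<in> horner (2 * Suc d)"
    using horner_funpow[OF Suc.IH[OF deg], of 2] by simp
  moreover have "(step ^^ d) (P', 0) \<in> horner (2 * Suc d)"
    by (rule horner_mono[OF Suc.IH[OF deg]]) simp
  ultimately show ?case by (simp only: horner_add)
qed

text \<open>Conjugation by \<open>mid\<close> acts on \<open>(a, c)\<close> through a matrix of
  determinant 1, which preserves the cocycle; hence \<open>b\<close> does not change.\<close>

lemma heis_step:
  fixes b :: "'k::field poly"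
  shows "heis (fst v) (snd v) b \<in> word_ball n \<Longrightarrow> heis (fst (step v)) (snd (step v)) b \<in> word_ball (n + 2)"
    "heis (fst (step v)) (snd (step v)) b \<in> word_ball n \<Longrightarrow> heis (fst v) (snd v) b \<in> word_ball (n + 2)"
proof -
  let ?T = "[:0, 1:] :: 'k poly"
  have w: "mid 0 (-1) 1 ?T \<in> gens" "mid ?T 1 (-1) 0 \<in> gens"
    by (auto intro!: mid_gens)
  show "heis (fst v) (snd v) b \<in> word_ball n \<Longrightarrow> heis (fst (step v)) (snd (step v)) b \<in> word_ball (n + 2)"
    by (erule word_ball_conj[OF _ w(1)])
       (simp add: sp_inv_mid, simp add: mid_def heis_def step_def m4_eq_iff algebra_simps)
  show "heis (fst (step v)) (snd (step v)) b \<in> word_ball n \<Longrightarrow> heis (fst v) (snd v) b \<in> word_ball (n + 2)"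
    by (erule word_ball_conj[OF _ w(2)])
       (simp add: sp_inv_mid, simp add: mid_def heis_def step_def m4_eq_iff algebra_simps)
qed

text \<open>Each Horner level costs two letters of conjugation and one generator. The cocycle terms
  pile up in \<open>z\<close>, which is left uncontrolled for now.\<close>

lemma heis_horner:
  fixes v :: "'k::field poly \<times> 'k poly"
  shows "v \<in> horner m \<Longrightarrow> \<exists>z. heis (fst v) (snd v) z \<in> word_ball (3 * m + 1)"
proof (induction m arbitrary: v)
  case 0
  thus ?case using gens_word_ball[OF heis_gens[of "fst v" "snd v" 0]] by auto
next
  case (Suc m)
  then obtain v' w where v: "v = step v' + w" "v' \<in> horner m" "degree (fst w) = 0" "degree (snd w) = 0"
    by auto
  obtain z where z: "heis (fst v') (snd v') z \<in> word_ball (3 * m + 1)" using Suc.IH v(2) by blast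
  have "heis (fst (step v')) (snd (step v')) z * heis (fst w) (snd w) 0 \<in> word_ball (3 * m + 1 + 2 + 1)"
    using heis_step(1)[OF z] v by (intro word_ball_mult gens_word_ball heis_gens) auto
  thus ?case unfolding heis_mult v(1) by (auto simp: eval_nat_numeral)
qed

text \<open>A Horner word of height \<open>2 * d\<close> costs \<open>6 * d + 1\<close> letters, and
  undoing \<open>step ^^ d\<close> by conjugations another \<open>2 * d\<close>.\<close>

lemma heis_short_mod_center:
  fixes P :: "'k::field poly"
  assumes "degree P \<le> d"
  shows "\<exists>z. heis P 0 z \<in> word_ball (8 * d + 1)"
proof -
  obtain z where z: "heis (fst ((step ^^ d) (P, 0))) (snd ((step ^^ d) (P, 0))) z \<in> word_ball (6 * d + 1)"
    using heis_horner[OF funpow_step_horner[OF assms]] by auto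
  have "heis (fst v) (snd v) z \<in> word_ball (n + 2 * k)"
    if "heis (fst ((step ^^ k) v)) (snd ((step ^^ k) v)) z \<in> word_ball n" for v k n
    using that
  proof (induction k arbitrary: n)
    case (Suc k)
    thus ?case using Suc.IH[OF heis_step(2)[of "(step ^^ k) v" z n]] by (simp add: algebra_simps)
  qed simp
  from this[OF z] show ?thesis by auto
qed

text \<open>Half of \<open>P\<close> goes into the first coordinate; the commutator with
  \<open>heis 0 1 0\<close> doubles it and cancels the unknown \<open>z\<close>.\<close>

lemma heis_center:
  fixes P :: "'k::field poly"
  assumes two: "(2::'k) \<noteq> 0" and "degree P \<le> d"
  shows "heis 0 0 P \<in> word_ball (16 * d + 4)"
proof -
  define Q where "Q = Polynomial.smult (1/2) P"
  have PQ: "P = Q + Q" unfolding Q_def using two smult_add_left[of "1/2" "1/2" P] by simp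
  have "degree Q \<le> d" unfolding Q_def using assms degree_smult_le order_trans by blast
  then obtain z where z: "heis Q 0 z \<in> word_ball (8 * d + 1)" using heis_short_mod_center by blast
  have one: "heis 0 1 0 \<in> word_ball 1" "heis 0 (-1) 0 \<in> (word_ball 1 :: 'k poly mat set)"
    by (rule gens_word_ball, rule heis_gens; simp)+
  have "heis Q 0 z * heis 0 1 0 * (heis (-Q) 0 (-z) * heis 0 (-1) 0) \<in>
      word_ball (8 * d + 1 + 1 + (8 * d + 1 + 1))"
    using word_ball_sp_inv[OF z] unfolding sp_inv_heis by (intro word_ball_mult z one) auto
  moreover have "heis Q 0 z * heis 0 1 0 * (heis (-Q) 0 (-z) * heis 0 (-1) 0) = heis 0 0 P"
    unfolding heis_mult PQ by simp
  ultimately have "heis 0 0 P \<in> word_ball (8 * d + 1 + 1 + (8 * d + 1 + 1))" by simp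
  thus ?thesis by (rule word_ball_monoD) simp
qed

text \<open>The unknown \<open>z\<close> is an entry of a word of length \<open>8 * d + 1\<close>,
  so its degree is at most that, and \<open>heis_center\<close> can remove it.\<close>

lemma heis_short:
  fixes P :: "'k::field poly"
  assumes two: "(2::'k) \<noteq> 0" and "degree P \<le> d"
  shows "heis P 0 0 \<in> word_ball (136 * d + 21)"
proof -
  obtain z where z: "heis P 0 z \<in> word_ball (8 * d + 1)" using heis_short_mod_center assms by blast
  have "degree (- z) \<le> 8 * d + 1"
    using mdeg_word_ball[OF z] unfolding heis_def mdeg_m4_le_iff by simp
  from word_ball_mult[OF z heis_center[OF two this]] show ?thesis
    unfolding heis_mult by (simp add: add.commute)
qed

text \<open>All are conjugates by constant matrices of the cases settled by
  \<open>heis_center\<close> and \<open>heis_short\<close>; 200 is a common crude constant.\<close>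

lemma elementary_word_ball:
  fixes P :: "'k::field poly"
  assumes two: "(2::'k) \<noteq> 0" and P: "degree P \<le> d"
  shows "outer 1 P 0 1 \<in> word_ball (200 * (d + 1))" "outer 1 0 P 1 \<in> word_ball (200 * (d + 1))"
    "mid 1 P 0 1 \<in> word_ball (200 * (d + 1))" "mid 1 0 P 1 \<in> word_ball (200 * (d + 1))"
    "levi 1 P 0 1 \<in> word_ball (200 * (d + 1))" "levi 1 0 P 1 \<in> word_ball (200 * (d + 1))"
    "heis 0 P 0 \<in> word_ball (200 * (d + 1))"
proof -
  have o1: "outer 1 P 0 1 \<in> word_ball (16 * d + 4)" if "degree P \<le> d" for P :: "'k poly"
    using heis_center[OF two that] by (simp add: heis_def outer_def)
  have l1: "levi 1 P 0 1 \<in> word_ball (136 * d + 21)"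
    using heis_short[OF two P] by (simp add: heis_def levi_def)
  have "degree (- P) \<le> d" using P by simp
  from word_ball_conj[OF o1[OF this] J_gens]
  have o2: "outer 1 0 P 1 \<in> word_ball (16 * d + 4 + 2)"
    by (simp add: sp_inv_J) (simp add: outer_def m4_J m4_eq_iff)
  have m1: "mid 1 P 0 1 \<in> word_ball (16 * d + 4 + 2)"
    using word_ball_conj[OF o1[OF P] swap_gens]
    by (simp add: sp_inv_swap) (simp add: outer_def mid_def swap_def m4_eq_iff)
  have m2: "mid 1 0 P 1 \<in> word_ball (16 * d + 4 + 2 + 2)"
    using word_ball_conj[OF o2 swap_gens]
    by (simp add: sp_inv_swap) (simp add: outer_def mid_def swap_def m4_eq_iff)
  have l2: "levi 1 0 P 1 \<in> word_ball (136 * d + 21 + 2)"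
    using word_ball_conj[OF l1 swap_gens]
    by (simp add: sp_inv_swap) (simp add: levi_def swap_def m4_eq_iff)
  have "mid 0 (-1) 1 0 \<in> (gens :: 'k poly mat set)" by (rule mid_gens) auto
  from word_ball_conj[OF heis_short[OF two P] this]
  have h: "heis 0 P 0 \<in> word_ball (136 * d + 21 + 2)"
    by (simp add: sp_inv_mid) (simp add: heis_def mid_def m4_eq_iff)
  show "outer 1 P 0 1 \<in> word_ball (200 * (d + 1))" "outer 1 0 P 1 \<in> word_ball (200 * (d + 1))"
    "mid 1 P 0 1 \<in> word_ball (200 * (d + 1))" "mid 1 0 P 1 \<in> word_ball (200 * (d + 1))"
    "levi 1 P 0 1 \<in> word_ball (200 * (d + 1))" "levi 1 0 P 1 \<in> word_ball (200 * (d + 1))"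
    "heis 0 P 0 \<in> word_ball (200 * (d + 1))"
    by (rule word_ball_monoD[OF o1[OF P]] word_ball_monoD[OF o2] word_ball_monoD[OF m1]
      word_ball_monoD[OF m2] word_ball_monoD[OF l1] word_ball_monoD[OF l2] word_ball_monoD[OF h]; simp)+
qed

section \<open>The Euclidean algorithm in a copy of \<open>SL_2\<close>\<close>

text \<open>Abstract in \<open>\<phi>\<close> to serve \<open>mid\<close>, \<open>outer\<close> and
  \<open>levi\<close>. The degrees of successive quotients telescope, so the cost is linear in
  \<open>D\<close> although there may be about \<open>D\<close> divisions.\<close>

lemma euclid_word_ball:
  fixes \<phi> :: "'k::field poly \<Rightarrow> 'k poly \<Rightarrow> 'k poly \<Rightarrow> 'k poly \<Rightarrow> 'k poly mat"
  assumes mult: "\<And>a b c d a' b' c' d'. \<phi> a b c d * \<phi> a' b' c' d' =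
      \<phi> (a * a' + b * c') (a * b' + b * d') (c * a' + d * c') (c * b' + d * d')"
    and upper: "\<And>P d. degree P \<le> d \<Longrightarrow> \<phi> 1 P 0 1 \<in> word_ball (K * (d + 1))"
    and lower: "\<And>P d. degree P \<le> d \<Longrightarrow> \<phi> 1 0 P 1 \<in> word_ball (K * (d + 1))"
    and "degree x \<le> D" "degree y \<le> D"
  obtains a b c d where "a * d - b * c = 1" "c * x + d * y = 0" "\<phi> a b c d \<in> word_ball (5 * K * (D + 1))"
proof -
  have "\<phi> 1 1 0 1 * \<phi> 1 0 (-1) 1 * \<phi> 1 1 0 1 \<in> word_ball (K * (0 + 1) + K * (0 + 1) + K * (0 + 1))"
    by (intro word_ball_mult upper lower) auto
  hence rot: "\<phi> 0 1 (-1) 0 \<in> word_ball (3 * K)" unfolding mult by (simp add: eval_nat_numeral add.assoc)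
  \<comment> \<open>The shift by one makes the measure drop even when a nonzero constant is replaced
    by 0.\<close>
  define e where "e y = (if y = 0 then 0 else degree y + 1)" for y :: "'k poly"
  have "\<exists>a b c d. a * d - b * c = 1 \<and> c * x + d * y = 0 \<and>
      \<phi> a b c d \<in> word_ball (K * (max (degree x) (degree y) + 4 * e y + 1))" for x y
  proof (induction "e y" arbitrary: x y rule: less_induct)
    case less
    show ?case
    proof (cases "y = 0")
      case True
      have "\<phi> 1 0 0 1 \<in> word_ball (K * (degree x + 1))" by (rule upper) simp
      thus ?thesis using True by (intro exI[of _ 1] exI[of _ 0]) (auto simp: e_def)
    next
      case False
      define Q where "Q = x div y"
      define r where "r = x mod y"
      have x: "x = Q * y + r" unfolding Q_def r_def by simp
      have r: "e r \<le> degree y" "r = 0 \<or> degree r < degree y"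
        using degree_mod_less[OF False, of x] unfolding r_def e_def by auto
      \<comment> \<open>The rotation sends \<open>(r, y)\<close> to \<open>(y, - r)\<close>, hence
        the sign.\<close>
      have "e (- r) < e y" using r(1) False unfolding e_def by auto
      have em: "e (- r) = e r" unfolding e_def by simp
      from less[OF \<open>e (- r) < e y\<close>, of y] obtain a b c d where M: "a * d - b * c = 1" "c * y + d * (- r) = 0"
        "\<phi> a b c d \<in> word_ball (K * (max (degree y) (degree r) + 4 * e r + 1))"
        unfolding em by auto
      have degQ: "degree Q + degree y \<le> max (degree x) (degree y)"
      proof (cases "Q = 0")
        case nz: False
        have "degree (Q * y) = degree (x - r)" by (subst x) simp
        also have "\<dots> \<le> max (degree x) (degree r)" by (rule degree_diff_le_max)
        also have "\<dots> \<le> max (degree x) (degree y)" using r(2) by auto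
        finally show ?thesis using nz False by (simp add: degree_mult_eq)
      qed simp
      have "\<phi> a b c d * (\<phi> 0 1 (-1) 0 * \<phi> 1 (-Q) 0 1) \<in>
          word_ball (K * (max (degree y) (degree r) + 4 * e r + 1) + (3 * K + K * (degree Q + 1)))"
        by (intro word_ball_mult M rot upper) simp
      moreover have "K * (max (degree y) (degree r) + 4 * e r + 1) + (3 * K + K * (degree Q + 1)) \<le>
          K * (max (degree x) (degree y) + 4 * e y + 1)"
      proof -
        \<comment> \<open>Each division lowers \<open>e\<close> by at least one. The four units
          released pay for the rotation and the constant part of the elementary matrix, and
          \<open>degQ\<close> pays for the quotient.\<close>
        have "max (degree y) (degree r) + 4 * e r + 1 + (3 + (degree Q + 1)) \<le>
            max (degree x) (degree y) + 4 * e y + 1"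
          using r degQ False unfolding e_def by auto
        from mult_le_mono2[OF this, of K] show ?thesis by (simp add: algebra_simps)
      qed
      ultimately have "\<phi> a b c d * (\<phi> 0 1 (-1) 0 * \<phi> 1 (-Q) 0 1) \<in>
          word_ball (K * (max (degree x) (degree y) + 4 * e y + 1))"
        by (rule word_ball_monoD)
      hence "\<phi> (- b) (a + b * Q) (- d) (c + d * Q) \<in>
          word_ball (K * (max (degree x) (degree y) + 4 * e y + 1))"
        unfolding mult by simp
      moreover have "(- b) * (c + d * Q) - (a + b * Q) * (- d) = 1"
        using M(1) by (simp add: algebra_simps)
      moreover have "(- d) * x + (c + d * Q) * y = 0"
        using M(2) by (subst x) (simp add: algebra_simps)
      ultimately show ?thesis by blast
    qed
  qed
  then obtain a b c d where M: "a * d - b * c = 1" "c * x + d * y = 0"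
    "\<phi> a b c d \<in> word_ball (K * (max (degree x) (degree y) + 4 * e y + 1))" by blast
  have "max (degree x) (degree y) + 4 * e y + 1 \<le> 5 * (D + 1)"
    using assms(4,5) unfolding e_def by auto
  from mult_le_mono2[OF this, of K] show thesis
    using M by (intro that[OF M(1,2)] word_ball_monoD[OF M(3)]) (simp add: algebra_simps)
qed

section \<open>Undistorted reduction to the Heisenberg subgroup\<close>

definition undistorted_on :: "('k::comm_ring_1 poly mat \<Rightarrow> bool) \<Rightarrow> bool" where
  "undistorted_on Q \<longleftrightarrow> (\<exists>C. \<forall>g\<in>Sp4. Q g \<longrightarrow> g \<in> word_ball (C * (mdeg g + 1)))"

text \<open>A multiplier \<open>w\<close> of length linear in \<open>mdeg g\<close> keeps
  \<open>mdeg (w * g)\<close> linear, so a bounded number of such reductions preserves linear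
  bounds.\<close>

lemma undistorted_on_reduce:
  assumes "undistorted_on Q'"
    and w: "\<And>g. g \<in> Sp4 \<Longrightarrow> Q g \<Longrightarrow> \<exists>w\<in>word_ball (L * (mdeg g + 1)). Q' (w * g)"
  shows "undistorted_on Q"
proof -
  obtain C where C: "\<And>g. g \<in> Sp4 \<Longrightarrow> Q' g \<Longrightarrow> g \<in> word_ball (C * (mdeg g + 1))"
    using assms(1) unfolding undistorted_on_def by blast
  have "g \<in> word_ball ((L + C * (L + 1)) * (mdeg g + 1))" if g: "g \<in> Sp4" "Q g" for g
  proof -
    obtain w where w: "w \<in> word_ball (L * (mdeg g + 1))" "Q' (w * g)" using w[OF g] by blast
    note wS = word_ball_Sp4[OF w(1)]
    have "mdeg (w * g) \<le> L * (mdeg g + 1) + mdeg g"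
      using mdeg_mult[OF Sp4_carrier[OF wS] Sp4_carrier[OF g(1)]] mdeg_word_ball[OF w(1)] by simp
    hence "C * (mdeg (w * g) + 1) \<le> C * ((L + 1) * (mdeg g + 1))"
      by (intro mult_le_mono2) (simp add: algebra_simps)
    hence "w * g \<in> word_ball (C * ((L + 1) * (mdeg g + 1)))"
      using C[OF mult_Sp4[OF wS g(1)] w(2)] word_ball_monoD by blast
    from word_ball_mult[OF word_ball_sp_inv[OF w(1)] this] show ?thesis
      unfolding sp_inv_mult_cancel[OF wS g(1)] by (simp add: algebra_simps)
  qed
  thus ?thesis unfolding undistorted_on_def by blast
qed

lemma degree_eq_0_of_mult_eq_1:
  fixes x y :: "'k::field poly"
  assumes "x * y = 1"
  shows "degree x = 0" "degree y = 0"
proof -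
  have "x \<noteq> 0" "y \<noteq> 0" using assms by auto
  hence "degree x + degree y = 0" using degree_mult_eq[of x y] assms by simp
  thus "degree x = 0" "degree y = 0" by auto
qed

section \<open>Reduction of the first two columns, last stage first\<close>

context
  assumes two: "(2::'k::field) \<noteq> 0"
begin

text \<open>Factor into the three coordinates. Reordering shifts the central one by
  \<open>a * c\<close>, which at most doubles the degree.\<close>

lemma undistorted_heis: "undistorted_on (\<lambda>g. \<exists>a c b. g = heis a c (b :: 'k poly))"
  unfolding undistorted_on_def
proof (rule exI[of _ 500], intro ballI impI, elim exE)
  fix g a c b assume g: "g = heis a c (b :: 'k poly)"
  let ?m = "mdeg g"
  have deg: "degree a \<le> ?m" "degree c \<le> ?m" "degree b \<le> ?m"
    using order_refl[of ?m] unfolding g by (subst (asm) heis_def, simp add: mdeg_m4_le_iff)+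
  have "degree (b - a * c) \<le> 2 * ?m"
    using deg order_trans[OF degree_mult_le[of a c]] by (intro degree_diff_le) auto
  have "heis a 0 0 * heis 0 c 0 * heis 0 0 (b - a * c) \<in>
      word_ball ((136 * ?m + 21) + (200 * (?m + 1)) + (16 * (2 * ?m) + 4))"
    by (intro word_ball_mult heis_short elementary_word_ball heis_center two deg) fact
  hence "g \<in> word_ball ((136 * ?m + 21) + (200 * (?m + 1)) + (16 * (2 * ?m) + 4))"
    unfolding heis_mult g by simp
  thus "g \<in> word_ball (500 * (?m + 1))" by (rule word_ball_monoD) simp
qed

text \<open>The symplectic equations leave \<open>g\<close> as the only deviation from Heisenberg
  form, and one elementary matrix of the middle copy clears it.\<close>

lemma undistorted_column_2:
  "undistorted_on (\<lambda>g :: 'k poly mat. g $$ (0, 0) = 1 \<and> g $$ (1, 0) = 0 \<and> g $$ (2, 0) = 0 \<and> g $$ (3, 0) = 0 \<and>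
     g $$ (1, 1) = 1 \<and> g $$ (2, 1) = 0)"
proof (rule undistorted_on_reduce[OF undistorted_heis, where L = 200])
  fix A :: "'k poly mat"
  assume A: "A \<in> Sp4" and Q: "A $$ (0, 0) = 1 \<and> A $$ (1, 0) = 0 \<and> A $$ (2, 0) = 0 \<and> A $$ (3, 0) = 0 \<and>
     A $$ (1, 1) = 1 \<and> A $$ (2, 1) = 0"
  obtain a b c d e f g h i j k l m n r s where m: "A = m4 a b c d e f g h i j k l m n r s"
    using m4_cases[OF Sp4_carrier[OF A]] by blast
  have A': "A = m4 1 b c d 0 1 g h 0 0 k l 0 n r s" using Q unfolding m by simp
  have eqs: "n = 0" "r = 0" "s = 1" "k = 1" "l = - b" "h = c + g * l"
    using A unfolding A' Sp4_m4 by (auto simp: algebra_simps eq_neg_iff_add_eq_0)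
  have "degree (- g) \<le> mdeg A" using order_refl[of "mdeg A"] unfolding m mdeg_m4_le_iff by simp
  hence "mid 1 (- g) 0 1 \<in> word_ball (200 * (mdeg A + 1))"
    by (rule elementary_word_ball(3)[OF two])
  moreover have "mid 1 (- g) 0 1 * A = heis b c d"
    unfolding A' mid_def heis_def by (simp add: m4_eq_iff eqs)
  ultimately show "\<exists>w\<in>word_ball (200 * (mdeg A + 1)). \<exists>a c b. w * A = heis a c b" by blast
qed

text \<open>The symplectic equations give \<open>f * k = 1\<close>, so both are constants and a
  single diagonal generator normalises the entry.\<close>

lemma undistorted_column_2_unit:
  "undistorted_on (\<lambda>g :: 'k poly mat. g $$ (0, 0) = 1 \<and> g $$ (1, 0) = 0 \<and> g $$ (2, 0) = 0 \<and> g $$ (3, 0) = 0 \<and>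
     g $$ (2, 1) = 0)"
proof (rule undistorted_on_reduce[OF undistorted_column_2, where L = 1])
  fix A :: "'k poly mat"
  assume A: "A \<in> Sp4" and Q: "A $$ (0, 0) = 1 \<and> A $$ (1, 0) = 0 \<and> A $$ (2, 0) = 0 \<and> A $$ (3, 0) = 0 \<and>
     A $$ (2, 1) = 0"
  obtain a b c d e f g h i j k l m n r s where m: "A = m4 a b c d e f g h i j k l m n r s"
    using m4_cases[OF Sp4_carrier[OF A]] by blast
  have A': "A = m4 1 b c d 0 f g h 0 0 k l 0 n r s" using Q unfolding m by simp
  have eqs: "n = 0" "r = 0" "s = 1" "f * k = 1"
    using A unfolding A' Sp4_m4 by auto
  have "mid k 0 0 f \<in> gens"
    using degree_eq_0_of_mult_eq_1[OF eqs(4)] eqs(4) by (intro mid_gens) (auto simp: mult.commute)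
  hence "mid k 0 0 f \<in> word_ball (1 * (mdeg A + 1))"
    by (rule word_ball_monoD[OF gens_word_ball]) simp
  moreover have "mid k 0 0 f * A = m4 1 b c d 0 1 (k * g) (k * h) 0 0 1 (f * l) 0 0 0 1"
    unfolding A' mid_def using eqs by (simp add: m4_eq_iff mult.commute)
  ultimately show "\<exists>w\<in>word_ball (1 * (mdeg A + 1)). (w * A) $$ (0, 0) = 1 \<and> (w * A) $$ (1, 0) = 0 \<and>
     (w * A) $$ (2, 0) = 0 \<and> (w * A) $$ (3, 0) = 0 \<and> (w * A) $$ (1, 1) = 1 \<and> (w * A) $$ (2, 1) = 0"
    by (intro bexI[of _ "mid k 0 0 f"]) (simp_all del: index_mult_mat)
qed

text \<open>Euclid in the middle copy on the second column; the first column, already a unit vector,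
  is fixed by \<open>mid\<close>.\<close>

lemma undistorted_column_1:
  "undistorted_on (\<lambda>g :: 'k poly mat. g $$ (0, 0) = 1 \<and> g $$ (1, 0) = 0 \<and> g $$ (2, 0) = 0 \<and> g $$ (3, 0) = 0)"
proof (rule undistorted_on_reduce[OF undistorted_column_2_unit, where L = 1000])
  fix A :: "'k poly mat"
  assume A: "A \<in> Sp4" and Q: "A $$ (0, 0) = 1 \<and> A $$ (1, 0) = 0 \<and> A $$ (2, 0) = 0 \<and> A $$ (3, 0) = 0"
  obtain a b c d e f g h i j k l m n r s where m: "A = m4 a b c d e f g h i j k l m n r s"
    using m4_cases[OF Sp4_carrier[OF A]] by blast
  have A': "A = m4 1 b c d 0 f g h 0 j k l 0 n r s" using Q unfolding m by simp
  have "degree f \<le> mdeg A" "degree j \<le> mdeg A"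
    using order_refl[of "mdeg A"] unfolding m mdeg_m4_le_iff by simp_all
  with euclid_word_ball[OF sl2_mult(1) elementary_word_ball(3,4)[OF two]]
  obtain x y z u where M: "x * u - y * z = 1" "z * f + u * j = 0"
      "mid x y z u \<in> word_ball (5 * 200 * (mdeg A + 1))" by metis
  have "(mid x y z u * A) $$ (2, 1) = 0" "(mid x y z u * A) $$ (0, 0) = 1" "(mid x y z u * A) $$ (1, 0) = 0"
    "(mid x y z u * A) $$ (2, 0) = 0" "(mid x y z u * A) $$ (3, 0) = 0"
    unfolding A' mid_def m4_mult using M(2) by simp_all
  thus "\<exists>w\<in>word_ball (1000 * (mdeg A + 1)). (w * A) $$ (0, 0) = 1 \<and> (w * A) $$ (1, 0) = 0 \<and>
     (w * A) $$ (2, 0) = 0 \<and> (w * A) $$ (3, 0) = 0 \<and> (w * A) $$ (2, 1) = 0"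
    using M(3) by (intro bexI[of _ "mid x y z u"]) simp_all
qed

lemma undistorted_column_1_unit:
  "undistorted_on (\<lambda>g :: 'k poly mat. g $$ (1, 0) = 0 \<and> g $$ (2, 0) = 0 \<and> g $$ (3, 0) = 0)"
proof (rule undistorted_on_reduce[OF undistorted_column_1, where L = 1])
  fix A :: "'k poly mat"
  assume A: "A \<in> Sp4" and Q: "A $$ (1, 0) = 0 \<and> A $$ (2, 0) = 0 \<and> A $$ (3, 0) = 0"
  obtain a b c d e f g h i j k l m n r s where m: "A = m4 a b c d e f g h i j k l m n r s"
    using m4_cases[OF Sp4_carrier[OF A]] by blast
  have A': "A = m4 a b c d 0 f g h 0 j k l 0 n r s" using Q unfolding m by simp
  have as: "a * s = 1" using A unfolding A' Sp4_m4 by simp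
  have "outer s 0 0 a \<in> gens"
    using degree_eq_0_of_mult_eq_1[OF as] as sl2_Sp4(2)[of s a 0 0]
    unfolding gens_def by (auto simp: mult.commute outer_def mdeg_m4_le_iff)
  hence "outer s 0 0 a \<in> word_ball (1 * (mdeg A + 1))"
    by (rule word_ball_monoD[OF gens_word_ball]) simp
  moreover have "(outer s 0 0 a * A) $$ (0, 0) = 1" "(outer s 0 0 a * A) $$ (1, 0) = 0"
    "(outer s 0 0 a * A) $$ (2, 0) = 0" "(outer s 0 0 a * A) $$ (3, 0) = 0"
    unfolding A' outer_def m4_mult using as by (simp_all add: mult.commute)
  ultimately show "\<exists>w\<in>word_ball (1 * (mdeg A + 1)). (w * A) $$ (0, 0) = 1 \<and> (w * A) $$ (1, 0) = 0 \<and>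
     (w * A) $$ (2, 0) = 0 \<and> (w * A) $$ (3, 0) = 0"
    by (intro bexI[of _ "outer s 0 0 a"]) simp_all
qed

text \<open>Euclid in \<open>levi\<close> on the upper half of the column; the lower rows are mixed
  only with each other, so their zeros persist.\<close>

lemma undistorted_column_1_upper:
  "undistorted_on (\<lambda>g :: 'k poly mat. g $$ (2, 0) = 0 \<and> g $$ (3, 0) = 0)"
proof (rule undistorted_on_reduce[OF undistorted_column_1_unit, where L = 1000])
  fix A :: "'k poly mat"
  assume A: "A \<in> Sp4" and Q: "A $$ (2, 0) = 0 \<and> A $$ (3, 0) = 0"
  obtain a b c d e f g h i j k l m n r s where m: "A = m4 a b c d e f g h i j k l m n r s"
    using m4_cases[OF Sp4_carrier[OF A]] by blast
  have A': "A = m4 a b c d e f g h 0 j k l 0 n r s" using Q unfolding m by simp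
  have "degree a \<le> mdeg A" "degree e \<le> mdeg A"
    using order_refl[of "mdeg A"] unfolding m mdeg_m4_le_iff by simp_all
  with euclid_word_ball[OF sl2_mult(3) elementary_word_ball(5,6)[OF two]]
  obtain x y z u where M: "x * u - y * z = 1" "z * a + u * e = 0"
      "levi x y z u \<in> word_ball (5 * 200 * (mdeg A + 1))" by metis
  have "(levi x y z u * A) $$ (1, 0) = 0" "(levi x y z u * A) $$ (2, 0) = 0"
    "(levi x y z u * A) $$ (3, 0) = 0"
    unfolding A' levi_def m4_mult using M(2) by simp_all
  thus "\<exists>w\<in>word_ball (1000 * (mdeg A + 1)). (w * A) $$ (1, 0) = 0 \<and>
     (w * A) $$ (2, 0) = 0 \<and> (w * A) $$ (3, 0) = 0"
    using M(3) by (intro bexI[of _ "levi x y z u"]) simp_all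
qed

text \<open>Euclid in \<open>outer\<close> touches only the first and last rows and so respects the
  zero already made.\<close>

lemma undistorted_column_1_middle:
  "undistorted_on (\<lambda>g :: 'k poly mat. g $$ (2, 0) = 0)"
proof (rule undistorted_on_reduce[OF undistorted_column_1_upper, where L = 1000])
  fix A :: "'k poly mat"
  assume A: "A \<in> Sp4" and Q: "A $$ (2, 0) = 0"
  obtain a b c d e f g h i j k l m n r s where m: "A = m4 a b c d e f g h i j k l m n r s"
    using m4_cases[OF Sp4_carrier[OF A]] by blast
  have A': "A = m4 a b c d e f g h 0 j k l m n r s" using Q unfolding m by simp
  have "degree a \<le> mdeg A" "degree m \<le> mdeg A"
    using order_refl[of "mdeg A"] unfolding m mdeg_m4_le_iff by simp_all
  with euclid_word_ball[OF sl2_mult(2) elementary_word_ball(1,2)[OF two]]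
  obtain x y z u where M: "x * u - y * z = 1" "z * a + u * m = 0"
      "outer x y z u \<in> word_ball (5 * 200 * (mdeg A + 1))" by metis
  have "(outer x y z u * A) $$ (2, 0) = 0" "(outer x y z u * A) $$ (3, 0) = 0"
    unfolding A' outer_def m4_mult using M(2) by simp_all
  thus "\<exists>w\<in>word_ball (1000 * (mdeg A + 1)). (w * A) $$ (2, 0) = 0 \<and> (w * A) $$ (3, 0) = 0"
    using M(3) by (intro bexI[of _ "outer x y z u"]) simp_all
qed

lemma undistorted_Sp4: "undistorted_on (\<lambda>g :: 'k poly mat. True)"
proof (rule undistorted_on_reduce[OF undistorted_column_1_middle, where L = 1000])
  fix A :: "'k poly mat"
  assume A: "A \<in> Sp4"
  obtain a b c d e f g h i j k l m n r s where m: "A = m4 a b c d e f g h i j k l m n r s"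
    using m4_cases[OF Sp4_carrier[OF A]] by blast
  have "degree e \<le> mdeg A" "degree i \<le> mdeg A"
    using order_refl[of "mdeg A"] unfolding m mdeg_m4_le_iff by simp_all
  with euclid_word_ball[OF sl2_mult(1) elementary_word_ball(3,4)[OF two]]
  obtain x y z u where M: "x * u - y * z = 1" "z * e + u * i = 0"
      "mid x y z u \<in> word_ball (5 * 200 * (mdeg A + 1))" by metis
  have "(mid x y z u * A) $$ (2, 0) = 0"
    unfolding m mid_def m4_mult using M(2) by simp
  thus "\<exists>w\<in>word_ball (1000 * (mdeg A + 1)). (w * A) $$ (2, 0) = 0"
    using M(3) by (intro bexI[of _ "mid x y z u"]) simp_all
qed

end

section \<open>Radial multipliers on the Heisenberg subgroup\<close>

text \<open>Translation by 1 permutes the field, so summing over it shows that the cardinality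
  vanishes in the field.\<close>

lemma two_neq_0_of_odd_card:
  assumes "odd (CARD('k::{finite,field}))"
  shows "(2::'k) \<noteq> 0"
proof
  assume two: "(2::'k) = 0"
  have "(\<Sum>x\<in>(UNIV::'k set). x + 1) = (\<Sum>x\<in>UNIV. x)"
    by (rule sum.reindex_bij_witness[of _ "\<lambda>x. x - 1" "\<lambda>x. x + 1"]) auto
  hence "(of_nat CARD('k) :: 'k) = 0" by (simp add: sum.distrib)
  moreover obtain m where "CARD('k) = 2 * m + 1" using assms by (elim oddE)
  ultimately show False using two by simp
qed

lemma finite_gens: "finite (gens :: 'k::{finite,field} poly mat set)"
proof (rule finite_subset)
  let ?I = "{..<4::nat} \<times> {..<4::nat}"
  show "gens \<subseteq> mat 4 4 ` (?I \<rightarrow>\<^sub>E (polys_lt 2 :: 'k poly set))"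
  proof
    fix A :: "'k poly mat" assume A: "A \<in> gens"
    have c: "A \<in> carrier_mat 4 4" using A gens_Sp4 Sp4_carrier by blast
    have "degree (A $$ (i, j)) < 2" if "i < 4" "j < 4" for i j
      using degree_le_mdeg[OF that, of A] A unfolding gens_def by simp
    hence "restrict (($$) A) ?I \<in> ?I \<rightarrow>\<^sub>E polys_lt 2"
      by (auto simp: polys_lt_iff_degree)
    moreover have "A = mat 4 4 (restrict (($$) A) ?I)"
      by (rule eq_matI) (use c in auto)
    ultimately show "A \<in> mat 4 4 ` (?I \<rightarrow>\<^sub>E (polys_lt 2 :: 'k poly set))" by blast
  qed
  show "finite (mat 4 4 ` (?I \<rightarrow>\<^sub>E (polys_lt 2 :: 'k poly set)))"
    by (intro finite_imageI finite_PiE) auto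
qed

section \<open>The length function and its comparison with word length\<close>

text \<open>The added 1 is for constant matrices, where \<open>mdeg\<close> is 0 but the word length
  may be positive; at the identity the word length is 0, hence the exception.\<close>

definition sp_length :: "'k::comm_ring_1 poly mat \<Rightarrow> real" where
  "sp_length g = (if g = 1\<^sub>m 4 then 0 else 1 + real (mdeg g))"

lemma is_length_fun_sp_length: "is_length_fun Sp4 (sp_length :: 'k::comm_ring_1 poly mat \<Rightarrow> real)"
  unfolding is_length_fun_def
proof (intro conjI ballI)
  fix g h :: "'k poly mat" assume g: "g \<in> Sp4" and h: "h \<in> Sp4"
  show "sp_length g \<ge> 0" unfolding sp_length_def by simp
  note c = Sp4_carrier[OF g] Sp4_carrier[OF h]
  show "sp_length (g * h) \<le> sp_length g + sp_length h"
    using mdeg_mult[OF c] left_mult_one_mat[OF c(2)] right_mult_one_mat[OF c(1)]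
    by (cases "g = 1\<^sub>m 4"; cases "h = 1\<^sub>m 4") (simp_all add: sp_length_def)
qed

lemma gens_union_inverses: "gens \<union> sp_inv ` gens = gens"
  using gens_sp_inv by auto

lemma sp_length_word_ball:
  assumes "g \<in> word_ball n"
  shows "sp_length g \<le> 2 * real n"
proof (cases n)
  case 0
  thus ?thesis using assms unfolding word_ball_def sp_length_def by auto
next
  case (Suc m)
  thus ?thesis using mdeg_word_ball[OF assms] unfolding sp_length_def by simp
qed

lemma word_length_gens:
  assumes "g \<in> word_ball n"
  shows "word_length gens g \<le> n" "g \<in> word_ball (word_length gens g)"
proof -
  let ?Q = "\<lambda>n. \<exists>xs. length xs = n \<and> set xs \<subseteq> gens \<union> sp_inv ` gens \<and> word_prod xs = g"
  obtain xs where xs: "length xs \<le> n" "set xs \<subseteq> gens" "word_prod xs = g"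
    using assms unfolding word_ball_def by blast
  have ex: "?Q (length xs)" unfolding gens_union_inverses using xs(2,3) by (intro exI[of _ xs]) simp
  show "word_length gens g \<le> n"
    unfolding word_length_def using Least_le[of ?Q, OF ex] xs(1) by (rule order_trans)
  have "?Q (word_length gens g)" unfolding word_length_def by (rule LeastI[of ?Q, OF ex])
  then obtain ys where "length ys = word_length gens g" "set ys \<subseteq> gens" "word_prod ys = g"
    unfolding gens_union_inverses by (elim exE conjE)
  thus "g \<in> word_ball (word_length gens g)"
    unfolding word_ball_def by (intro CollectI exI[of _ ys]) simp
qed

lemma sp_length_bilipschitz:
  assumes "odd (CARD('k::{finite,field}))"
  shows "generates gens (Sp4 :: 'k poly mat set)"
    "\<exists>C>0. \<forall>g\<in>(Sp4 :: 'k poly mat set). sp_length g \<le> C * real (word_length gens g) \<and>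
       real (word_length gens g) \<le> C * sp_length g"
proof -
  obtain C where C: "\<And>g :: 'k poly mat. g \<in> Sp4 \<Longrightarrow> g \<in> word_ball (C * (mdeg g + 1))"
    using undistorted_Sp4[OF two_neq_0_of_odd_card[OF assms]] unfolding undistorted_on_def by blast
  show "generates gens (Sp4 :: 'k poly mat set)"
    unfolding generates_def gens_union_inverses
  proof (intro conjI ballI gens_Sp4)
    fix g :: "'k poly mat" assume "g \<in> Sp4"
    from C[OF this] show "\<exists>xs. set xs \<subseteq> gens \<and> word_prod xs = g"
      unfolding word_ball_def by auto
  qed
  show "\<exists>C>0. \<forall>g\<in>(Sp4 :: 'k poly mat set). sp_length g \<le> C * real (word_length gens g) \<and>
       real (word_length gens g) \<le> C * sp_length g"
  \<comment> \<open>The 2 comes from \<open>sp_length_word_ball\<close>, the \<open>C\<close> from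
    \<open>undistorted_Sp4\<close>; the sum is positive and serves both inequalities.\<close>
  proof (intro exI[of _ "real (C + 2)"] conjI ballI)
    fix g :: "'k poly mat" assume g: "g \<in> Sp4"
    have "sp_length g \<le> 2 * real (word_length gens g)"
      by (rule sp_length_word_ball[OF word_length_gens(2)[OF C[OF g]]])
    also have "\<dots> \<le> real (C + 2) * real (word_length gens g)"
      by (intro mult_right_mono) auto
    finally show "sp_length g \<le> real (C + 2) * real (word_length gens g)" .
    show "real (word_length gens g) \<le> real (C + 2) * sp_length g"
    proof (cases "g = 1\<^sub>m 4")
      case True
      have "word_length gens g \<le> 0" unfolding True by (rule word_length_gens(1)[OF word_ball_one])
      thus ?thesis unfolding True sp_length_def by simp
    next
      case False
      have "real (word_length gens g) \<le> real (C * (mdeg g + 1))"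
        using word_length_gens(1)[OF C[OF g]] by (simp only: of_nat_le_iff)
      also have "\<dots> = real C * sp_length g" using False unfolding sp_length_def by (simp add: algebra_simps)
      also have "\<dots> \<le> real (C + 2) * sp_length g"
        unfolding sp_length_def by (intro mult_right_mono) auto
      finally show ?thesis .
    qed
  qed simp
qed

section \<open>Decay of the radial profile\<close>

text \<open>A representative of length \<open>k + 1\<close>: the radial profile of \<open>f\<close>
  at \<open>k\<close> is read off as \<open>f (central k)\<close>.\<close>

definition central :: "nat \<Rightarrow> 'k::comm_ring_1 poly mat" where
  "central k = heis 0 0 (monom 1 k)"

lemma central_Sp4: "central k \<in> Sp4"
  unfolding central_def by (rule heis_Sp4)

lemma sp_length_heis:
  fixes u :: "'k::comm_ring_1 poly"
  assumes "u \<in> polys_lt (Suc k)" "u \<notin> polys_lt k" "a \<in> polys_lt (Suc k)" "c \<in> polys_lt (Suc k)"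
  shows "sp_length (heis a c u) = 1 + real k"
proof -
  have u: "u \<noteq> 0" "degree u = k" using assms(1,2) by (auto simp: polys_lt_iff_degree)
  hence "heis a c u \<noteq> 1\<^sub>m 4" unfolding heis_def m4_one m4_eq_iff by simp
  moreover have "mdeg (heis a c u) \<le> k"
    using assms(3,4) u unfolding heis_def mdeg_m4_le_iff by (auto simp: polys_lt_iff_degree)
  moreover have "k \<le> mdeg (heis a c u)"
    using degree_le_mdeg[of 0 3 "heis a c u"] u unfolding heis_def by simp
  ultimately show ?thesis unfolding sp_length_def by simp
qed

lemma monom_polys_lt: "monom (1::'k::comm_ring_1) k \<in> polys_lt (Suc k)" "monom (1::'k) k \<notin> polys_lt k"
  by (auto simp: polys_lt_iff_degree degree_monom_eq)

lemma radial_heis_eq_central: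
  fixes u :: "'k::comm_ring_1 poly"
  assumes "radial_on Sp4 sp_length f"
    "u \<in> polys_lt (Suc k)" "u \<notin> polys_lt k" "a \<in> polys_lt (Suc k)" "c \<in> polys_lt (Suc k)"
  shows "f (heis a c u) = f (central k)"
proof -
  have "sp_length (heis a c u) = sp_length (central k :: 'k poly mat)"
    using sp_length_heis[OF assms(2-5)]
      sp_length_heis[of "monom (1::'k) k" k 0 0, OF monom_polys_lt] unfolding central_def by simp
  thus ?thesis using assms(1) heis_Sp4 central_Sp4 unfolding radial_on_def by blast
qed

text \<open>Applies the multiplier to the test matrix with entries \<open>deg_diff n\<close>, and
  compares the lower bound for the image with the upper bound for the matrix itself.\<close>

lemma schur_bounded_central_diff:
  fixes f :: "'k::{finite,field} poly mat \<Rightarrow> complex"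
  assumes radial: "radial_on Sp4 sp_length f" and bdd: "schur_bounded p Sp4 f M"
    and p: "p \<ge> 2" and n: "n \<ge> 2"
  shows "real CARD('k) ^ n * cmod (f (central n) - f (central (Suc n))) \<le>
    \<bar>M\<bar> * ((4 * real CARD('k) ^ (n + 2)) powr (p/2 - 1) * (2 * real CARD('k) ^ (3 * n))) powr (1/p)"
proof -
  let ?A = "polys_lt n :: 'k poly set" and ?B = "polys_lt (2 * n) :: 'k poly set"
  \<comment> \<open>The signs are those of an inverse, so that \<open>sp_inv x * y\<close> gets
    central coordinate \<open>b + d + a * c\<close>.\<close>
  define \<xi> where "\<xi> = (\<lambda>(a, b). heis (- a) 0 (- b) :: 'k poly mat)"
  define \<eta> where "\<eta> = (\<lambda>(c, d). heis 0 c d :: 'k poly mat)"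
  define X where "X = \<xi> ` (?A \<times> ?B)"
  define Y where "Y = \<eta> ` (?A \<times> ?B)"
  define T where "T x y = (if x \<in> X \<and> y \<in> Y then complex_of_real (deg_diff n ((sp_inv x * y) $$ (0, 3))) else 0)"
    for x y
  have prod: "sp_inv (\<xi> (a, b)) * \<eta> (c, d) = heis a c (b + d + a * c)" for a b c d
    unfolding \<xi>_def \<eta>_def by (simp add: sp_inv_heis heis_mult)
  have fin: "finite (X \<union> Y)" unfolding X_def Y_def by simp
  have inj: "inj_on \<xi> (?A \<times> ?B)" "inj_on \<eta> (?A \<times> ?B)"
    unfolding \<xi>_def \<eta>_def heis_def inj_on_def by (auto simp: m4_eq_iff)
  interpret T: bilinear_index n "X \<union> Y" \<xi> \<eta> T
    by unfold_locales (use n fin inj in \<open>auto simp: X_def Y_def T_def\<close>)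
  interpret fT: bilinear_index n "X \<union> Y" \<xi> \<eta> "\<lambda>x y. f (sp_inv x * y) * T x y"
    by unfold_locales (use n fin inj in \<open>auto simp: X_def Y_def T_def\<close>)
  have T: "T (\<xi> (a, b)) (\<eta> (c, d)) = complex_of_real (deg_diff n (b + d + a * c))"
    if "a \<in> ?A" "b \<in> ?B" "c \<in> ?A" "d \<in> ?B" for a b c d
    using that unfolding T_def prod X_def Y_def by (auto simp: heis_def)
  have fT: "f (sp_inv (\<xi> (a, b)) * \<eta> (c, d)) * T (\<xi> (a, b)) (\<eta> (c, d)) =
      f (central n) * complex_of_real (unif_deg n (b + d + a * c)) -
      f (central (Suc n)) * complex_of_real (unif_deg (Suc n) (b + d + a * c))"
    if ac: "a \<in> ?A" "b \<in> ?B" "c \<in> ?A" "d \<in> ?B" for a b c d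
  proof -
    \<comment> \<open>Where \<open>unif_deg k u\<close> is nonzero, \<open>u\<close> has degree
      \<open>k\<close> and dominates \<open>a\<close> and \<open>c\<close>, of degree below
      \<open>n \<le> k\<close>; radiality then replaces the value of \<open>f\<close> by the profile
      at \<open>k\<close>.\<close>
    have eq: "f (heis a c u) * complex_of_real (unif_deg k u) = f (central k) * complex_of_real (unif_deg k u)"
      if "k = n \<or> k = Suc n" for u k
    proof (cases "u \<in> polys_lt (Suc k) - polys_lt k")
      case True
      have "polys_lt n \<subseteq> (polys_lt (Suc k) :: 'k poly set)"
        using that by (intro polys_lt_mono) auto
      hence "f (heis a c u) = f (central k)"
        using True ac radial by (intro radial_heis_eq_central) auto
      thus ?thesis by simp
    qed (auto simp: unif_deg_def)
    show ?thesis
      unfolding T[OF ac] prod deg_diff_def of_real_diff right_diff_distrib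
        eq[of n, OF disjI1[OF refl]] eq[of "Suc n", OF disjI2[OF refl]] ..
  qed
  have "real CARD('k) ^ n * cmod (f (central n) - f (central (Suc n))) \<le>
      schatten_norm p (X \<union> Y) (\<lambda>x y. f (sp_inv x * y) * T x y)"
    by (rule fT.schatten_norm_ge_deg_diff[OF fT]) (use p in auto)
  also have "\<dots> \<le> M * schatten_norm p (X \<union> Y) T"
  proof -
    have "X \<union> Y \<subseteq> Sp4" unfolding X_def Y_def \<xi>_def \<eta>_def using heis_Sp4 by auto
    thus ?thesis using bdd fin unfolding schur_bounded_def by blast
  qed
  also have "\<dots> \<le> \<bar>M\<bar> * schatten_norm p (X \<union> Y) T"
    by (intro mult_right_mono schatten_norm_nonneg) simp
  also have "\<dots> \<le> \<bar>M\<bar> * ((4 * real CARD('k) ^ (n + 2)) powr (p/2 - 1) * (2 * real CARD('k) ^ (3 * n))) powr (1/p)"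
    by (intro mult_left_mono T.schatten_norm_le_deg_diff[OF T p]) auto
  finally show ?thesis .
qed

text \<open>Isolates the dependence on \<open>n\<close>. The factor \<open>q ^ n\<close> will cancel
  against the lower bound, and the remaining ratio is below 1 for \<open>q > 1\<close> exactly when
  \<open>p > 4\<close>.\<close>

lemma powr_bound_rewrite:
  fixes q p :: real
  assumes q: "q > 0" and p: "p > 0"
  shows "((4 * q ^ (n + 2)) powr (p/2 - 1) * (2 * q ^ (3 * n))) powr (1/p) =
    ((4 * q\<^sup>2) powr (p/2 - 1) * 2) powr (1/p) * (q ^ n * (q powr (2/p - 1/2)) ^ n)"
proof -
  have "(4 * q ^ (n + 2)) powr (p/2 - 1) = (4 * q\<^sup>2) powr (p/2 - 1) * (q ^ n) powr (p/2 - 1)"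
    using q by (simp add: powr_mult[symmetric] power_add power2_eq_square mult_ac)
  hence "((4 * q ^ (n + 2)) powr (p/2 - 1) * (2 * q ^ (3 * n))) powr (1/p) =
      ((4 * q\<^sup>2) powr (p/2 - 1) * 2) powr (1/p) * ((q ^ n) powr (p/2 - 1) * q ^ (3 * n)) powr (1/p)"
    using q by (simp add: powr_mult[symmetric] mult_ac)
  also have "((q ^ n) powr (p/2 - 1) * q ^ (3 * n)) powr (1/p) = q powr ((real n * (p/2 - 1) + 3 * real n) * (1/p))"
    using q by (simp add: powr_realpow[symmetric] powr_powr powr_add[symmetric])
  also have "(real n * (p/2 - 1) + 3 * real n) * (1/p) = real n + (2/p - 1/2) * real n + 0"
    using p by (simp add: field_simps)
  also have "q powr (real n + (2/p - 1/2) * real n + 0) = q ^ n * (q powr (2/p - 1/2)) ^ n"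
    using q by (simp add: powr_add powr_realpow powr_power mult.commute)
  finally show ?thesis .
qed

text \<open>Telescope from \<open>n\<close> into the zero range. The bound does not contain
  \<open>N\<close>, so it is uniform over functions of arbitrary finite support.\<close>

lemma norm_le_geometric_tail:
  fixes \<phi> :: "nat \<Rightarrow> complex"
  assumes diff: "\<And>n. n \<ge> m \<Longrightarrow> cmod (\<phi> n - \<phi> (Suc n)) \<le> B * r ^ n"
    and r: "0 \<le> r" "r < 1" and B: "B \<ge> 0" and zero: "\<And>n. n \<ge> N \<Longrightarrow> \<phi> n = 0" and n: "n \<ge> m"
  shows "cmod (\<phi> n) \<le> B * r ^ n / (1 - r)"
proof -
  have tel: "cmod (\<phi> n - \<phi> (n + j)) \<le> B * r ^ n * (1 - r ^ j) / (1 - r)" for j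
  proof (induction j)
    case (Suc j)
    have "cmod (\<phi> n - \<phi> (n + Suc j)) \<le> cmod (\<phi> n - \<phi> (n + j)) + cmod (\<phi> (n + j) - \<phi> (Suc (n + j)))"
      using norm_triangle_ineq[of "\<phi> n - \<phi> (n + j)" "\<phi> (n + j) - \<phi> (Suc (n + j))"] by simp
    also have "\<dots> \<le> B * r ^ n * (1 - r ^ j) / (1 - r) + B * r ^ (n + j)"
      by (intro add_mono Suc.IH diff) (use n in simp)
    also have "\<dots> = B * r ^ n * (1 - r ^ Suc j) / (1 - r)"
      using r by (simp add: field_simps power_add)
    finally show ?case .
  qed simp
  have "cmod (\<phi> n) \<le> B * r ^ n * (1 - r ^ N) / (1 - r)"
    using tel[of N] zero[of "n + N"] by simp
  also have "\<dots> \<le> B * r ^ n * 1 / (1 - r)"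
    using r B by (intro divide_right_mono mult_left_mono) auto
  finally show ?thesis by simp
qed

lemma fin_supp_central:
  fixes f :: "'k::comm_ring_1 poly mat \<Rightarrow> complex"
  assumes "fin_supp_on Sp4 f"
  shows "\<exists>N. \<forall>n\<ge>N. f (central n) = 0"
proof -
  have "inj (central :: nat \<Rightarrow> 'k poly mat)"
  proof (rule injI)
    fix m n assume "central m = (central n :: 'k poly mat)"
    hence "degree (monom (1::'k) m) = degree (monom (1::'k) n)"
      unfolding central_def heis_def m4_eq_iff by simp
    thus "m = n" by (simp add: degree_monom_eq)
  qed
  hence "finite {n. central n \<in> {g \<in> Sp4. f g \<noteq> 0}}"
    using finite_vimageI[of "{g \<in> Sp4. f g \<noteq> 0}" central] assms
    unfolding fin_supp_on_def vimage_def by blast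
  then obtain N where "\<And>n. f (central n) \<noteq> 0 \<Longrightarrow> n < N"
    using central_Sp4 unfolding finite_nat_set_iff_bounded by blast
  thus ?thesis by (meson not_less)
qed

text \<open>The quantifier order matters: \<open>n\<close> depends on \<open>p\<close>,
  \<open>M\<close> and the field, but not on \<open>f\<close>.\<close>

lemma central_uniform_decay:
  assumes p: "p > 4"
  shows "\<exists>n. \<forall>f :: 'k::{finite,field} poly mat \<Rightarrow> complex. fin_supp_on Sp4 f \<longrightarrow>
    radial_on Sp4 sp_length f \<longrightarrow> schur_bounded p Sp4 f M \<longrightarrow> cmod (f (central n)) < 1/2"
proof -
  let ?q = "real CARD('k)"
  have q: "?q \<ge> 2" by (rule two_le_card_field)
  define B where "B = \<bar>M\<bar> * ((4 * ?q\<^sup>2) powr (p/2 - 1) * 2) powr (1/p)"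
  define r where "r = ?q powr (2/p - 1/2)"
  have "2/p - 1/2 < 0" using p by (simp add: field_simps)
  hence r: "0 \<le> r" "r < 1" unfolding r_def using q powr_less_mono[of "2/p - 1/2" 0 ?q] by auto
  have B: "B \<ge> 0" unfolding B_def by simp
  have "(\<lambda>n. B * r ^ n / (1 - r)) \<longlonglongrightarrow> B * 0 / (1 - r)"
    using r by (intro tendsto_intros LIMSEQ_power_zero) auto
  hence "\<forall>\<^sub>F n in sequentially. B * r ^ n / (1 - r) < 1/2"
    by (rule order_tendstoD) simp
  then obtain n where n: "n \<ge> 2" "B * r ^ n / (1 - r) < 1/2"
    unfolding eventually_sequentially by (meson max.cobounded1 max.cobounded2)
  have "cmod (f (central n)) < 1/2"
    if f: "fin_supp_on Sp4 f" "radial_on Sp4 sp_length f" "schur_bounded p Sp4 f M"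
    for f :: "'k poly mat \<Rightarrow> complex"
  proof -
    obtain N where N: "\<And>n. n \<ge> N \<Longrightarrow> f (central n) = 0" using fin_supp_central[OF f(1)] by blast
    have diff: "cmod (f (central m) - f (central (Suc m))) \<le> B * r ^ m" if "m \<ge> 2" for m
    proof -
      have "?q ^ m * cmod (f (central m) - f (central (Suc m))) \<le> ?q ^ m * (B * r ^ m)"
        using schur_bounded_central_diff[OF f(2,3) _ that] powr_bound_rewrite[of ?q p m] p q
        unfolding B_def r_def by (simp add: mult_ac)
      thus ?thesis using q by simp
    qed
    have "cmod (f (central n)) \<le> B * r ^ n / (1 - r)"
      by (rule norm_le_geometric_tail[where m = 2 and N = N and \<phi> = "\<lambda>n. f (central n)"])
         (use diff r B N n in auto)
    thus ?thesis using n(2) by linarith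
  qed
  thus ?thesis by blast
qed

text \<open>A family with a pointwise limit is encoded as a proper filter on functions, for instance
  the one generated by the tails of a net.\<close>

theorem theorem1p5:
  fixes dummy :: "'k::{finite,field}"
  assumes "odd (CARD('k))"
  shows "\<exists>l :: 'k poly mat \<Rightarrow> real.
     is_length_fun Sp4 l \<and>
     (\<exists>S. finite S \<and> generates S Sp4 \<and>
        (\<exists>C>0. \<forall>g\<in>Sp4. l g \<le> C * real (word_length S g) \<and> real (word_length S g) \<le> C * l g)) \<and>
     (\<forall>p::real. p > 4 \<longrightarrow>
        \<not> (\<exists>F :: ('k poly mat \<Rightarrow> complex) filter. F \<noteq> bot \<and>
              (\<exists>M. \<forall>\<^sub>F f in F. fin_supp_on Sp4 f \<and> radial_on Sp4 l f \<and> schur_bounded p Sp4 f M) \<and>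
              (\<forall>g\<in>Sp4. ((\<lambda>f. f g) \<longlongrightarrow> 1) F)))"
proof (intro exI[of _ sp_length] conjI allI impI)
  show "is_length_fun Sp4 (sp_length :: 'k poly mat \<Rightarrow> real)"
    by (rule is_length_fun_sp_length)
  show "\<exists>S. finite S \<and> generates S (Sp4 :: 'k poly mat set) \<and>
        (\<exists>C>0. \<forall>g\<in>Sp4. sp_length g \<le> C * real (word_length S g) \<and> real (word_length S g) \<le> C * sp_length g)"
    by (intro exI[of _ gens] conjI finite_gens sp_length_bilipschitz assms)
  fix p :: real assume p: "p > 4"
  show "\<not> (\<exists>F :: ('k poly mat \<Rightarrow> complex) filter. F \<noteq> bot \<and>
              (\<exists>M. \<forall>\<^sub>F f in F. fin_supp_on Sp4 f \<and> radial_on Sp4 sp_length f \<and> schur_bounded p Sp4 f M) \<and>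
              (\<forall>g\<in>Sp4. ((\<lambda>f. f g) \<longlongrightarrow> 1) F))"
  proof (intro notI, elim exE conjE)
    fix F :: "('k poly mat \<Rightarrow> complex) filter" and M
    assume F: "F \<noteq> bot"
      and M: "\<forall>\<^sub>F f in F. fin_supp_on Sp4 f \<and> radial_on Sp4 sp_length f \<and> schur_bounded p Sp4 f M"
      and lim: "\<forall>g\<in>Sp4. ((\<lambda>f. f g) \<longlongrightarrow> 1) F"
    obtain n where n: "\<And>f :: 'k poly mat \<Rightarrow> complex. fin_supp_on Sp4 f \<Longrightarrow>
        radial_on Sp4 sp_length f \<Longrightarrow> schur_bounded p Sp4 f M \<Longrightarrow> cmod (f (central n)) < 1/2"
      using central_uniform_decay[OF p] by blast
    have "((\<lambda>f. f (central n)) \<longlongrightarrow> 1) F" using lim central_Sp4 by blast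
    hence "\<forall>\<^sub>F f in F. dist (f (central n)) 1 < 1/2" by (rule tendstoD) simp
    \<comment> \<open>At the single element \<open>central n\<close>, values eventually within 1/2
      of 1 would also have modulus below 1/2.\<close>
    with M have "\<forall>\<^sub>F f in F. False"
    proof eventually_elim
      case (elim f)
      hence "cmod (f (central n)) < 1/2" "cmod (1 - f (central n)) < 1/2"
        using n[of f] by (auto simp: dist_norm norm_minus_commute)
      thus ?case using norm_triangle_ineq[of "f (central n)" "1 - f (central n)"] by simp
    qed
    thus False using F by (simp add: eventually_False)
  qed
qed

end
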